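(* Let $C$ be a commutative ring, let $q,z\in C$ be invertible with $Q=q-q^{-1}$ invertible in $C$, let $Z_0^{(\ell)}\in C$ for $\ell\in\mathbb{Z}$, and let $i\ge1$ be an integer. Let $W_{i+1}$ be the affine BMW algebra (on $k=i+1$ strands) over $C$ with these parameters. Let $u$ be a variable and put $U_i^+=\frac{Y_i}{u-Y_i}$ and $U_{i+1}^+=\frac{Y_{i+1}}{u-Y_{i+1}}$. Then the following two identities hold in $W_{i+1}[[u^{-1}]]$: $$\left(E_i\frac{Y_{i+1}}{u-Y_{i+1}}-\frac{T_i}{Q}-\frac{Y_iY_{i+1}}{u^2-Y_iY_{i+1}}\right)\left(E_i\frac{Y_i}{u-Y_i}+\frac{T_i^{-1}}{Q}-\frac{Y_iY_{i+1}}{u^2-Y_iY_{i+1}}\right)=\frac{-(u^2-q^2Y_iY_{i+1})(u^2-q^{-2}Y_iY_{i+1})}{Q^2(u^2-Y_iY_{i+1})^2},$$ and $$\left(U_{i+1}^++\frac{T_i}{Q}-E_i\frac{Y_iY_{i+1}}{u^2-Y_iY_{i+1}}\right)-Q^2(U_i^++1)\left(U_{i+1}^++\frac{T_i}{Q}-E_i\frac{Y_iY_{i+1}}{u^2-Y_iY_{i+1}}\right)U_i^+$$ $$=\left(T_iU_i^+T_i^{-1}+\frac{T_i}{Q}-E_i\frac{Y_iY_{i+1}}{u^2-Y_iY_{i+1}}\right)-Q^2U_{i+1}^+\left(E_iU_i^+E_i+z\frac{E_i}{Q}-E_i\frac{Y_iY_{i+1}}{u^2-Y_iY_{i+1}}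\right)(U_{i+1}^++1).$$
   Context: The affine braid group $B_k$ is the group generated by $T_1,\ldots,T_{k-1}$ and $X^{\varepsilon_1}$ with relations $T_iT_j=T_jT_i$ if $j\ne i\pm1$; $T_iT_{i+1}T_i=T_{i+1}T_iT_{i+1}$ for $1\le i\le k-2$; $X^{\varepsilon_1}T_1X^{\varepsilon_1}T_1=T_1X^{\varepsilon_1}T_1X^{\varepsilon_1}$; and $X^{\varepsilon_1}T_i=T_iX^{\varepsilon_1}$ for $2\le i\le k-1$. Let $CB_k$ be its group algebra over $C$. In $CB_k$ put $Y_1=zX^{\varepsilon_1}$ and $Y_i=T_{i-1}Y_{i-1}T_{i-1}$ for $2\le i\le k$ (the $Y_i$ commute with each other), and define $E_i$, for $1\le i\le k-1$, by $$T_iY_i=Y_{i+1}T_i-(q-q^{-1})Y_{i+1}(1-E_i),\quad\text{equivalently}\quad E_i=1-\frac{T_i-T_i^{-1}}{q-q^{-1}}.$$ The affine BMW algebra $W_k$ is the quotient of $CB_k$ by the relations (for all indices for which they make sense) $$E_iT_i^{\pm1}=T_i^{\pm1}E_i=z^{\mp1}E_i,\qquad E_iT_{i-1}^{\pm1}E_i=E_iT_{i+1}^{\pm1}E_i=z^{\pm1}E_i,$$ $$E_1Y_1^{\ell}E_1=Z_0^{(\ell)}E_1\ (\ell\in\mathbb{Z}),\qquad E_iY_iY_{i+1}=E_i=Y_iY_{i+1}E_i.$$ The variable $u$ commutes with everything, and rational expressions in $u$ are expanded as power series in $u^{-1}$, e.g. $\frac{Y}{u-Y}=\sum_{\ell\ge1}Y^{\ell}u^{-\ell}$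 and $\frac{P}{u^2-P}=\sum_{\ell\ge1}P^{\ell}u^{-2\ell}$. *)

theory Defs
  imports "HOL-Algebra.Algebra"
begin

section \<open>Groups given by generators and relations\<close>

text \<open>A letter \<open>(a, True)\<close> stands for the generator \<open>a\<close>, and \<open>(a, False)\<close> for its
  formal inverse.\<close>

type_synonym 'a signed_word = "('a \<times> bool) list"

inductive pres_eq ::
    "'a set \<Rightarrow> ('a signed_word \<times> 'a signed_word) set \<Rightarrow> 'a signed_word \<Rightarrow> 'a signed_word \<Rightarrow> bool"
  for A R where
  refl: "w \<in> lists (A \<times> UNIV) \<Longrightarrow> pres_eq A R w w"
| sym: "pres_eq A R v w \<Longrightarrow> pres_eq A R w v"
| trans: "pres_eq A R u v \<Longrightarrow> pres_eq A R v w \<Longrightarrow> pres_eq A R u w"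
| append: "pres_eq A R v v' \<Longrightarrow> pres_eq A R w w' \<Longrightarrow> pres_eq A R (v @ w) (v' @ w')"
| cancel: "a \<in> A \<Longrightarrow> pres_eq A R [(a, b), (a, \<not> b)] []"
| relator: "(v, w) \<in> R \<Longrightarrow> v \<in> lists (A \<times> UNIV) \<Longrightarrow> w \<in> lists (A \<times> UNIV) \<Longrightarrow> pres_eq A R v w"

definition pres_class ::
    "'a set \<Rightarrow> ('a signed_word \<times> 'a signed_word) set \<Rightarrow> 'a signed_word \<Rightarrow> 'a signed_word set" where
  "pres_class A R w = {v. pres_eq A R w v}"

definition presented_group ::
    "'a set \<Rightarrow> ('a signed_word \<times> 'a signed_word) set \<Rightarrow> 'a signed_word set monoid" where
  "presented_group A R =
     \<lparr>carrier = pres_class A R ` lists (A \<times> UNIV),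
      monoid.mult = (\<lambda>V W. \<Union>v\<in>V. \<Union>w\<in>W. pres_class A R (v @ w)),
      monoid.one = pres_class A R []\<rparr>"


section \<open>The affine braid group\<close>

datatype braid_gen = TGen nat | XGen

abbreviation pos_word :: "'a list \<Rightarrow> 'a signed_word" where
  "pos_word as \<equiv> map (\<lambda>a. (a, True)) as"

definition braid_gens :: "nat \<Rightarrow> braid_gen set" where
  "braid_gens k = insert XGen (TGen ` {1..<k})"

definition braid_rels :: "nat \<Rightarrow> (braid_gen signed_word \<times> braid_gen signed_word) set" where
  "braid_rels k =
     {(pos_word [TGen i, TGen j], pos_word [TGen j, TGen i]) |i j.
        i \<in> {1..<k} \<and> j \<in> {1..<k} \<and> j \<noteq> i + 1 \<and> i \<noteq> j + 1}
   \<union> {(pos_word [TGen i, TGen (i + 1), TGen i], pos_word [TGen (i + 1), TGen i, TGen (i + 1)]) |i.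
        1 \<le> i \<and> i + 1 < k}
   \<union> (if 2 \<le> k
       then {(pos_word [XGen, TGen 1, XGen, TGen 1], pos_word [TGen 1, XGen, TGen 1, XGen])}
       else {})
   \<union> {(pos_word [XGen, TGen i], pos_word [TGen i, XGen]) |i. i \<in> {2..<k}}"

definition affine_braid_group :: "nat \<Rightarrow> braid_gen signed_word set monoid" where
  "affine_braid_group k = presented_group (braid_gens k) (braid_rels k)"

definition braid_elem :: "nat \<Rightarrow> braid_gen \<Rightarrow> braid_gen signed_word set" where
  "braid_elem k a = pres_class (braid_gens k) (braid_rels k) [(a, True)]"


section \<open>Group algebras\<close>

text \<open>Finitely supported functions on the group, with convolution as multiplication; functions
  are extensional, i.e. \<^const>\<open>undefined\<close> outside the carrier of the group.\<close>

definition group_algebra ::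
    "('c, 'm) ring_scheme \<Rightarrow> ('g, 'n) monoid_scheme \<Rightarrow> ('g \<Rightarrow> 'c) ring" where
  "group_algebra C G =
     \<lparr>carrier = {f \<in> carrier G \<rightarrow>\<^sub>E carrier C. finite {x \<in> carrier G. f x \<noteq> \<zero>\<^bsub>C\<^esub>}},
      monoid.mult = (\<lambda>f h. \<lambda>x\<in>carrier G.
        \<Oplus>\<^bsub>C\<^esub>y\<in>{y \<in> carrier G. f y \<noteq> \<zero>\<^bsub>C\<^esub>}. f y \<otimes>\<^bsub>C\<^esub> h (inv\<^bsub>G\<^esub> y \<otimes>\<^bsub>G\<^esub> x)),
      monoid.one = (\<lambda>x\<in>carrier G. if x = \<one>\<^bsub>G\<^esub> then \<one>\<^bsub>C\<^esub> else \<zero>\<^bsub>C\<^esub>),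
      ring.zero = (\<lambda>x\<in>carrier G. \<zero>\<^bsub>C\<^esub>),
      ring.add = (\<lambda>f h. \<lambda>x\<in>carrier G. f x \<oplus>\<^bsub>C\<^esub> h x)\<rparr>"

text \<open>The element \<open>c \<cdot> g\<close> of the group algebra.\<close>

definition ga_single ::
    "('c, 'm) ring_scheme \<Rightarrow> ('g, 'n) monoid_scheme \<Rightarrow> 'c \<Rightarrow> 'g \<Rightarrow> 'g \<Rightarrow> 'c" where
  "ga_single C G c g = (\<lambda>x\<in>carrier G. if x = g then c else \<zero>\<^bsub>C\<^esub>)"


section \<open>The affine BMW algebra\<close>

type_synonym 'c braid_alg = "braid_gen signed_word set \<Rightarrow> 'c"

definition CB :: "('c, 'm) ring_scheme \<Rightarrow> nat \<Rightarrow> 'c braid_alg ring" where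
  "CB C k = group_algebra C (affine_braid_group k)"

definition CB_scalar :: "('c, 'm) ring_scheme \<Rightarrow> nat \<Rightarrow> 'c \<Rightarrow> 'c braid_alg" where
  "CB_scalar C k c = ga_single C (affine_braid_group k) c \<one>\<^bsub>affine_braid_group k\<^esub>"

definition CB_T :: "('c, 'm) ring_scheme \<Rightarrow> nat \<Rightarrow> nat \<Rightarrow> 'c braid_alg" where
  "CB_T C k i = ga_single C (affine_braid_group k) \<one>\<^bsub>C\<^esub> (braid_elem k (TGen i))"

definition CB_X :: "('c, 'm) ring_scheme \<Rightarrow> nat \<Rightarrow> 'c braid_alg" where
  "CB_X C k = ga_single C (affine_braid_group k) \<one>\<^bsub>C\<^esub> (braid_elem k XGen)"

text \<open>Indices start at 1; \<open>CB_Y C z k 0\<close> is left unspecified.\<close>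

fun CB_Y :: "('c, 'm) ring_scheme \<Rightarrow> 'c \<Rightarrow> nat \<Rightarrow> nat \<Rightarrow> 'c braid_alg" where
  "CB_Y C z k (Suc 0) = CB_scalar C k z \<otimes>\<^bsub>CB C k\<^esub> CB_X C k"
| "CB_Y C z k (Suc (Suc n)) =
     CB_T C k (Suc n) \<otimes>\<^bsub>CB C k\<^esub> CB_Y C z k (Suc n) \<otimes>\<^bsub>CB C k\<^esub> CB_T C k (Suc n)"

text \<open>Solving the defining equation \<open>T\<^sub>i Y\<^sub>i = Y\<^sub>i\<^sub>+\<^sub>1 T\<^sub>i - (q - q\<^sup>-\<^sup>1) Y\<^sub>i\<^sub>+\<^sub>1 (1 - E\<^sub>i)\<close> for \<open>E\<^sub>i\<close>, using
  that \<open>Y\<^sub>i\<^sub>+\<^sub>1 = T\<^sub>i Y\<^sub>i T\<^sub>i\<close> is invertible, gives \<open>E\<^sub>i = 1 - (T\<^sub>i - T\<^sub>i\<^sup>-\<^sup>1) / (q - q\<^sup>-\<^sup>1)\<close>.\<close>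

definition CB_E :: "('c, 'm) ring_scheme \<Rightarrow> 'c \<Rightarrow> nat \<Rightarrow> nat \<Rightarrow> 'c braid_alg" where
  "CB_E C q k i =
     \<one>\<^bsub>CB C k\<^esub> \<ominus>\<^bsub>CB C k\<^esub>
       CB_scalar C k (inv\<^bsub>C\<^esub> (q \<ominus>\<^bsub>C\<^esub> inv\<^bsub>C\<^esub> q)) \<otimes>\<^bsub>CB C k\<^esub>
         (CB_T C k i \<ominus>\<^bsub>CB C k\<^esub> inv\<^bsub>CB C k\<^esub> (CB_T C k i))"

text \<open>Each pair \<open>(a, b)\<close> encodes the relation \<open>a = b\<close>; \<open>T'\<close> and \<open>z'\<close> are inverses. For \<open>k < 2\<close>
  there is no \<open>E\<^sub>1\<close>, hence no relation involving \<open>Z0\<close>.\<close>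

definition BMW_rels ::
    "('c, 'm) ring_scheme \<Rightarrow> 'c \<Rightarrow> 'c \<Rightarrow> (int \<Rightarrow> 'c) \<Rightarrow> nat \<Rightarrow> ('c braid_alg \<times> 'c braid_alg) set" where
  "BMW_rels C q z Z0 k =
    (let mul = monoid.mult (CB C k); T = CB_T C k; T' = (\<lambda>i. inv\<^bsub>CB C k\<^esub> (CB_T C k i));
         E = CB_E C q k; Y = CB_Y C z k;
         sc = CB_scalar C k; z' = inv\<^bsub>C\<^esub> z
     in (\<Union>i\<in>{1..<k}.
          {(mul (E i) (T i), mul (sc z') (E i)), (mul (T i) (E i), mul (sc z') (E i)),
           (mul (E i) (T' i), mul (sc z) (E i)), (mul (T' i) (E i), mul (sc z) (E i)),
           (mul (mul (E i) (Y i)) (Y (i + 1)), E i), (mul (mul (Y i) (Y (i + 1))) (E i), E i)})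
      \<union> (\<Union>i\<in>{2..<k}.
          {(mul (mul (E i) (T (i - 1))) (E i), mul (sc z) (E i)),
           (mul (mul (E i) (T' (i - 1))) (E i), mul (sc z') (E i))})
      \<union> (\<Union>i\<in>{i. 1 \<le> i \<and> i + 1 < k}.
          {(mul (mul (E i) (T (i + 1))) (E i), mul (sc z) (E i)),
           (mul (mul (E i) (T' (i + 1))) (E i), mul (sc z') (E i))})
      \<union> {(mul (mul (E 1) (Y 1 [^]\<^bsub>CB C k\<^esub> l)) (E 1), mul (sc (Z0 l)) (E 1)) |l::int. 2 \<le> k})"

definition BMW_ideal ::
    "('c, 'm) ring_scheme \<Rightarrow> 'c \<Rightarrow> 'c \<Rightarrow> (int \<Rightarrow> 'c) \<Rightarrow> nat \<Rightarrow> 'c braid_alg set" where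
  "BMW_ideal C q z Z0 k = genideal (CB C k) {a \<ominus>\<^bsub>CB C k\<^esub> b |a b. (a, b) \<in> BMW_rels C q z Z0 k}"

definition affine_BMW ::
    "('c, 'm) ring_scheme \<Rightarrow> 'c \<Rightarrow> 'c \<Rightarrow> (int \<Rightarrow> 'c) \<Rightarrow> nat \<Rightarrow> 'c braid_alg set ring" where
  "affine_BMW C q z Z0 k = CB C k Quot BMW_ideal C q z Z0 k"

definition BMW_proj ::
    "('c, 'm) ring_scheme \<Rightarrow> 'c \<Rightarrow> 'c \<Rightarrow> (int \<Rightarrow> 'c) \<Rightarrow> nat \<Rightarrow> 'c braid_alg \<Rightarrow> 'c braid_alg set" where
  "BMW_proj C q z Z0 k a = BMW_ideal C q z Z0 k +>\<^bsub>CB C k\<^esub> a"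


section \<open>Power series in \<open>u\<^sup>-\<^sup>1\<close> over a possibly noncommutative ring\<close>

text \<open>The value at \<open>n\<close> is the coefficient of \<open>u\<close> to the power \<open>-n\<close>; the variable \<open>u\<close> is central.\<close>

definition power_series_ring :: "('w, 'm) ring_scheme \<Rightarrow> (nat \<Rightarrow> 'w) ring" where
  "power_series_ring W =
     \<lparr>carrier = UNIV \<rightarrow> carrier W,
      monoid.mult = (\<lambda>f g n. \<Oplus>\<^bsub>W\<^esub>j\<in>{..n}. f j \<otimes>\<^bsub>W\<^esub> g (n - j)),
      monoid.one = (\<lambda>n. if n = 0 then \<one>\<^bsub>W\<^esub> else \<zero>\<^bsub>W\<^esub>),
      ring.zero = (\<lambda>n. \<zero>\<^bsub>W\<^esub>),
      ring.add = (\<lambda>f g n. f n \<oplus>\<^bsub>W\<^esub> g n)\<rparr>"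

definition ps_const :: "('w, 'm) ring_scheme \<Rightarrow> 'w \<Rightarrow> nat \<Rightarrow> 'w" where
  "ps_const W a = (\<lambda>n. if n = 0 then a else \<zero>\<^bsub>W\<^esub>)"

definition ps_uinv :: "('w, 'm) ring_scheme \<Rightarrow> nat \<Rightarrow> 'w" where
  "ps_uinv W = (\<lambda>n. if n = 1 then \<one>\<^bsub>W\<^esub> else \<zero>\<^bsub>W\<^esub>)"

text \<open>The expansion of \<open>a / (u\<^sup>m - a)\<close>, i.e. the sum over \<open>l \<ge> 1\<close> of \<open>a\<^sup>l\<close> times \<open>u\<close> to the
  power \<open>-m l\<close>; used with \<open>m \<ge> 1\<close>.\<close>

definition ps_frac :: "('w, 'm) ring_scheme \<Rightarrow> nat \<Rightarrow> 'w \<Rightarrow> nat \<Rightarrow> 'w" where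
  "ps_frac W m a = (\<lambda>n. if 0 < n \<and> m dvd n then a [^]\<^bsub>W\<^esub> (n div m) else \<zero>\<^bsub>W\<^esub>)"

end

theory Submission
  imports Defs
begin

text \<open>
  Put \<open>x = Y\<^sub>i u\<^sup>-\<^sup>1\<close> and \<open>y = Y\<^sub>i\<^sub>+\<^sub>1 u\<^sup>-\<^sup>1\<close>, so that \<open>U = x (1 - x)\<^sup>-\<^sup>1\<close>, \<open>V = y (1 - y)\<^sup>-\<^sup>1\<close> and
  \<open>F = x y (1 - x y)\<^sup>-\<^sup>1\<close>.
  The relation \<open>y = T x T\<close> says \<open>T x = y T\<^sup>-\<^sup>1 = y T - Q y (1 - E)\<close>, and multiplying it with
  \<open>(1 - y)\<^sup>-\<^sup>1\<close> from the left and \<open>(1 - x)\<^sup>-\<^sup>1\<close> from the right turns it into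
  \<open>V T\<^sup>-\<^sup>1 = T U + Q V (1 - E) U\<close> and similar relations. Since \<open>x\<close> and \<open>y\<close> commute,
  \<open>U V = F (U + V + 1)\<close>, and \<open>x y\<close> commutes with \<open>T\<close>, hence \<open>F\<close> commutes with \<open>T\<close> and \<open>E\<close>. Both
  identities follow by expanding, with \<open>E T\<^sup>-\<^sup>1 = z E\<close>.
\<close>

section \<open>Presented groups and group algebras\<close>

text \<open>The obstacle is noncommutativity: fractions cannot be cleared freely. The remedy is to
  characterise each series by a two-sided fixed-point equation such as
  \<open>U = x + x U = x + U x\<close>, which says that 1 + U inverts 1 - x. Whatever commutes with
  x then commutes with U, and no coefficients have to be compared; both identities become statements
  about an arbitrary ring containing such elements. In the first identity the mixed terms reduce to
  E V U, and its expansion through F leaves F + F^2 - 1/Q^2. Since q^2 + q^(-2) = Q^2 + 2, this is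
  the stated fraction. In the second identity the two products multiplied by Q^2 differ by a single
  term X / Q, and Q X = V - T U T^(-1) is the difference of the remaining terms. That Y_i and
  Y_(i+1) commute is derived from the braid relations by induction on i. The group algebra and the
  power series are given as bare records, so their ring axioms are proved as well.\<close>

lemma pres_eq_lists:
  assumes "pres_eq A R v w"
  shows "v \<in> lists (A \<times> UNIV) \<and> w \<in> lists (A \<times> UNIV)"
  using assms by induction auto

lemma pres_class_eq_iff:
  assumes "v \<in> lists (A \<times> UNIV)"
  shows "pres_class A R v = pres_class A R w \<longleftrightarrow> pres_eq A R v w"
proof
  assume "pres_class A R v = pres_class A R w"
  moreover have "v \<in> pres_class A R v"
    using assms by (simp add: pres_class_def pres_eq.refl)
  ultimately show "pres_eq A R v w"
    by (simp add: pres_class_def pres_eq.sym)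
next
  assume "pres_eq A R v w"
  then show "pres_class A R v = pres_class A R w"
    unfolding pres_class_def
    by (intro Collect_cong iffI) (erule (1) pres_eq.trans pres_eq.trans[OF pres_eq.sym])+
qed

lemma carrier_presented_group:
  "carrier (presented_group A R) = pres_class A R ` lists (A \<times> UNIV)"
  by (simp add: presented_group_def)

text \<open>The product is a union over all pairs of representatives. By the congruence rule
  \<open>append\<close> all these classes coincide, and since neither factor is empty the union
  collapses to one class.\<close>

lemma pres_class_mult:
  assumes "v \<in> lists (A \<times> UNIV)" and "w \<in> lists (A \<times> UNIV)"
  shows "pres_class A R v \<otimes>\<^bsub>presented_group A R\<^esub> pres_class A R w = pres_class A R (v @ w)"
proof -
  have *: "pres_class A R (v' @ w') = pres_class A R (v @ w)"
    if "v' \<in> pres_class A R v" and "w' \<in> pres_class A R w" for v' w'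
  proof -
    have "pres_eq A R (v @ w) (v' @ w')"
      using that by (simp add: pres_class_def pres_eq.append)
    then show ?thesis
      by (metis pres_class_eq_iff pres_eq_lists)
  qed
  have "v \<in> pres_class A R v" and "w \<in> pres_class A R w"
    using assms by (simp_all add: pres_class_def pres_eq.refl)
  then have "pres_class A R v \<noteq> {}" and "pres_class A R w \<noteq> {}"
    by auto
  then have "(\<Union>v'\<in>pres_class A R v. \<Union>w'\<in>pres_class A R w. pres_class A R (v' @ w'))
      = pres_class A R (v @ w)"
    by (simp add: * cong: SUP_cong)
  then show ?thesis
    by (simp add: presented_group_def)
qed

text \<open>Cancellation happens in the middle: the first letter of the word meets its own inverse,
  which stands last in the reversed word. What remains is the same statement for the tail.\<close>

lemma pres_eq_inverse_word:
  assumes "w \<in> lists (A \<times> UNIV)"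
  shows "pres_eq A R (map (\<lambda>(a, b). (a, \<not> b)) (rev w) @ w) []"
  using assms
proof (induction w)
  case Nil
  then show ?case by (simp add: pres_eq.refl)
next
  case (Cons p w)
  obtain a b where p: "p = (a, b)" by force
  let ?v = "map (\<lambda>(a, b). (a, \<not> b)) (rev w)"
  have v: "?v \<in> lists (A \<times> UNIV)" and w: "w \<in> lists (A \<times> UNIV)" and "a \<in> A"
    using Cons.hyps p by auto
  then have "pres_eq A R [(a, \<not> b), (a, b)] []"
    using pres_eq.cancel[of a A R "\<not> b"] by simp
  then have "pres_eq A R (?v @ [(a, \<not> b), (a, b)] @ w) (?v @ [] @ w)"
    using v w by (intro pres_eq.append pres_eq.refl)
  with Cons.IH show ?case
    by (simp add: p pres_eq.trans)
qed

text \<open>\<open>groupI\<close> asks for a left unit and left inverses, and the reversed word with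
  flipped signs is such an inverse.\<close>

lemma group_presented_group: "group (presented_group A R)"
proof (rule groupI)
  let ?L = "lists (A \<times> (UNIV :: bool set))"
  show "\<one>\<^bsub>presented_group A R\<^esub> \<in> carrier (presented_group A R)"
    by (auto simp: presented_group_def)
  have one: "\<one>\<^bsub>presented_group A R\<^esub> = pres_class A R []"
    by (simp add: presented_group_def)
  fix V assume "V \<in> carrier (presented_group A R)"
  then obtain v where v: "V = pres_class A R v" "v \<in> ?L"
    by (auto simp: carrier_presented_group)
  show "\<one>\<^bsub>presented_group A R\<^esub> \<otimes>\<^bsub>presented_group A R\<^esub> V = V"
    using v by (simp add: one pres_class_mult)
  let ?v' = "map (\<lambda>(a, b). (a, \<not> b)) (rev v)"
  have v': "?v' \<in> ?L"
    using v(2) by auto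
  then have "pres_class A R ?v' \<otimes>\<^bsub>presented_group A R\<^esub> V = \<one>\<^bsub>presented_group A R\<^esub>"
    using v pres_eq_inverse_word[OF v(2), of R] pres_eq_lists
    by (metis one pres_class_eq_iff pres_class_mult)
  with v' show "\<exists>V'\<in>carrier (presented_group A R).
      V' \<otimes>\<^bsub>presented_group A R\<^esub> V = \<one>\<^bsub>presented_group A R\<^esub>"
    by (auto simp: carrier_presented_group)
  fix W assume "W \<in> carrier (presented_group A R)"
  then obtain w where w: "W = pres_class A R w" "w \<in> ?L"
    by (auto simp: carrier_presented_group)
  show "V \<otimes>\<^bsub>presented_group A R\<^esub> W \<in> carrier (presented_group A R)"
    using v w by (auto simp: carrier_presented_group pres_class_mult)
  fix Z assume "Z \<in> carrier (presented_group A R)"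
  then obtain x where x: "Z = pres_class A R x" "x \<in> ?L"
    by (auto simp: carrier_presented_group)
  show "V \<otimes>\<^bsub>presented_group A R\<^esub> W \<otimes>\<^bsub>presented_group A R\<^esub> Z
      = V \<otimes>\<^bsub>presented_group A R\<^esub> (W \<otimes>\<^bsub>presented_group A R\<^esub> Z)"
    using v w x by (simp add: pres_class_mult)
qed

lemma presented_group_relator:
  assumes "(v, w) \<in> R" and "v \<in> lists (A \<times> UNIV)" and "w \<in> lists (A \<times> UNIV)"
  shows "pres_class A R v = pres_class A R w"
  using assms by (simp add: pres_class_eq_iff pres_eq.relator)

section \<open>Convolution in group algebras\<close>

lemma (in abelian_monoid) finsum_swap:
  assumes "finite A" and "finite B" and "\<And>a b. a \<in> A \<Longrightarrow> b \<in> B \<Longrightarrow> f a b \<in> carrier G"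
  shows "(\<Oplus>a\<in>A. \<Oplus>b\<in>B. f a b) = (\<Oplus>b\<in>B. \<Oplus>a\<in>A. f a b)"
  using assms(1,3)
proof (induction A)
  case empty
  then show ?case by (simp add: finsum_zero)
next
  case (insert x A)
  have "(\<Oplus>b\<in>B. \<Oplus>a\<in>insert x A. f a b) = (\<Oplus>b\<in>B. f x b \<oplus> (\<Oplus>a\<in>A. f a b))"
    using insert by (intro finsum_cong') (auto intro!: finsum_closed)
  also have "\<dots> = (\<Oplus>b\<in>B. f x b) \<oplus> (\<Oplus>b\<in>B. \<Oplus>a\<in>A. f a b)"
    using insert by (intro finsum_addf) (auto intro!: finsum_closed)
  finally show ?case
    using insert by (simp add: Pi_def finsum_closed)
qed

locale group_ring = R: ring R + G: group G
  for R :: "('c, 'm) ring_scheme" (structure) and G :: "('g, 'n) monoid_scheme"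
begin

abbreviation "RG \<equiv> group_algebra R G"

definition supp :: "('g \<Rightarrow> 'c) \<Rightarrow> 'g set" where
  "supp f = {x \<in> carrier G. f x \<noteq> \<zero>}"

lemma carrier_iff:
  "f \<in> carrier RG \<longleftrightarrow> f \<in> carrier G \<rightarrow>\<^sub>E carrier R \<and> finite (supp f)"
  by (simp add: group_algebra_def supp_def)

lemma coeff_closed: "f \<in> carrier RG \<Longrightarrow> x \<in> carrier G \<Longrightarrow> f x \<in> carrier R"
  by (auto simp: carrier_iff)

lemma eqI:
  assumes "f \<in> carrier RG" and "h \<in> carrier RG" and "\<And>x. x \<in> carrier G \<Longrightarrow> f x = h x"
  shows "f = h"
  using assms by (intro PiE_ext[of f "carrier G" "\<lambda>_. carrier R" h]) (auto simp: carrier_iff)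

text \<open>Terms outside the support of \<open>f\<close> vanish, so the index set may be enlarged
  to any finite \<open>B\<close>. This is what allows sums with different supports to be added,
  exchanged and reindexed.\<close>

lemma mult_eq:
  assumes "f \<in> carrier RG" and "h \<in> carrier RG" and "finite B"
    and "supp f \<subseteq> B" and "B \<subseteq> carrier G" and "x \<in> carrier G"
  shows "(f \<otimes>\<^bsub>RG\<^esub> h) x = (\<Oplus>y\<in>B. f y \<otimes> h (inv\<^bsub>G\<^esub> y \<otimes>\<^bsub>G\<^esub> x))"
proof -
  have "(f \<otimes>\<^bsub>RG\<^esub> h) x = (\<Oplus>y\<in>supp f. f y \<otimes> h (inv\<^bsub>G\<^esub> y \<otimes>\<^bsub>G\<^esub> x))"
    using assms(6) by (simp add: group_algebra_def supp_def)
  also have "\<dots> = (\<Oplus>y\<in>B. f y \<otimes> h (inv\<^bsub>G\<^esub> y \<otimes>\<^bsub>G\<^esub> x))"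
  proof (rule R.add.finprod_mono_neutral_cong_left)
    fix y assume y: "y \<in> B - supp f"
    then have "f y = \<zero>"
      using assms(5) by (auto simp: supp_def)
    then show "f y \<otimes> h (inv\<^bsub>G\<^esub> y \<otimes>\<^bsub>G\<^esub> x) = \<zero>"
      using y assms(2,5,6) coeff_closed[of h "inv\<^bsub>G\<^esub> y \<otimes>\<^bsub>G\<^esub> x"] by auto
  next
    show "(\<lambda>y. f y \<otimes> h (inv\<^bsub>G\<^esub> y \<otimes>\<^bsub>G\<^esub> x)) \<in> B \<rightarrow> carrier R"
      using assms by (auto intro!: R.m_closed coeff_closed[OF assms(1)] coeff_closed[OF assms(2)])
  qed (use assms in auto)
  finally show ?thesis .
qed

text \<open>A nonzero coefficient at x needs a nonzero summand at some y, and then x = y (y^(-1) x)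
  is a product of support elements.\<close>

lemma supp_mult:
  assumes f: "f \<in> carrier RG" and h: "h \<in> carrier RG"
  shows "supp (f \<otimes>\<^bsub>RG\<^esub> h) \<subseteq> (\<lambda>(a, b). a \<otimes>\<^bsub>G\<^esub> b) ` (supp f \<times> supp h)"
proof
  fix x assume x: "x \<in> supp (f \<otimes>\<^bsub>RG\<^esub> h)"
  then have xG: "x \<in> carrier G" by (simp add: supp_def)
  have "(\<Oplus>y\<in>supp f. f y \<otimes> h (inv\<^bsub>G\<^esub> y \<otimes>\<^bsub>G\<^esub> x)) \<noteq> \<zero>"
    using x f h mult_eq[OF f h, of "supp f" x] by (auto simp: supp_def carrier_iff)
  then have "\<exists>y\<in>supp f. f y \<otimes> h (inv\<^bsub>G\<^esub> y \<otimes>\<^bsub>G\<^esub> x) \<noteq> \<zero>"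
    using R.add.finprod_one_eqI[of "supp f" "\<lambda>y. f y \<otimes> h (inv\<^bsub>G\<^esub> y \<otimes>\<^bsub>G\<^esub> x)"] by auto
  then obtain y where y: "y \<in> supp f" "f y \<otimes> h (inv\<^bsub>G\<^esub> y \<otimes>\<^bsub>G\<^esub> x) \<noteq> \<zero>"
    by auto
  then have yG: "y \<in> carrier G" by (simp add: supp_def)
  then have "inv\<^bsub>G\<^esub> y \<otimes>\<^bsub>G\<^esub> x \<in> supp h"
    using y xG f by (auto simp: supp_def coeff_closed)
  moreover have "x = y \<otimes>\<^bsub>G\<^esub> (inv\<^bsub>G\<^esub> y \<otimes>\<^bsub>G\<^esub> x)"
    using xG yG by (simp add: G.m_assoc[symmetric])
  ultimately show "x \<in> (\<lambda>(a, b). a \<otimes>\<^bsub>G\<^esub> b) ` (supp f \<times> supp h)"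
    using y(1) by force
qed

lemma mult_closed:
  assumes f: "f \<in> carrier RG" and h: "h \<in> carrier RG"
  shows "f \<otimes>\<^bsub>RG\<^esub> h \<in> carrier RG"
proof -
  have "finite (supp (f \<otimes>\<^bsub>RG\<^esub> h))"
    using finite_subset[OF supp_mult[OF f h]] f h by (simp add: carrier_iff)
  moreover have "f \<otimes>\<^bsub>RG\<^esub> h \<in> carrier G \<rightarrow>\<^sub>E carrier R"
    using f h unfolding group_algebra_def
    by (auto intro!: R.finsum_closed R.m_closed)
  ultimately show ?thesis
    by (simp add: carrier_iff)
qed

text \<open>Both sides are the double sum of f(a) h(a^(-1) y) k(y^(-1) x) over a in the support of
  \<open>f\<close> and y in the finite set \<open>B\<close> of products. They are matched by
  exchanging the sums and substituting b = a^(-1) y in the inner convolution.\<close>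

lemma mult_assoc:
  assumes f: "f \<in> carrier RG" and h: "h \<in> carrier RG" and k: "k \<in> carrier RG"
  shows "f \<otimes>\<^bsub>RG\<^esub> h \<otimes>\<^bsub>RG\<^esub> k = f \<otimes>\<^bsub>RG\<^esub> (h \<otimes>\<^bsub>RG\<^esub> k)"
proof (rule eqI)
  fix x assume x: "x \<in> carrier G"
  define B where "B = (\<lambda>(a, b). a \<otimes>\<^bsub>G\<^esub> b) ` (supp f \<times> supp h)"
  have finf: "finite (supp f)" and finB: "finite B"
    using f h by (simp_all add: carrier_iff B_def)
  have suppG: "supp f \<subseteq> carrier G" and BG: "B \<subseteq> carrier G"
    by (auto simp: supp_def B_def)
  have closed: "f a \<in> carrier R" "h (inv\<^bsub>G\<^esub> a \<otimes>\<^bsub>G\<^esub> y) \<in> carrier R"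
      "k (inv\<^bsub>G\<^esub> y \<otimes>\<^bsub>G\<^esub> x) \<in> carrier R" if "a \<in> supp f" "y \<in> B" for a y
    using that x suppG BG
    by (auto intro!: coeff_closed[OF f] coeff_closed[OF h] coeff_closed[OF k])
  have "(f \<otimes>\<^bsub>RG\<^esub> h \<otimes>\<^bsub>RG\<^esub> k) x
      = (\<Oplus>y\<in>B. (f \<otimes>\<^bsub>RG\<^esub> h) y \<otimes> k (inv\<^bsub>G\<^esub> y \<otimes>\<^bsub>G\<^esub> x))"
    using f h k x finB BG by (intro mult_eq) (simp_all add: mult_closed supp_mult B_def)
  also have "\<dots> = (\<Oplus>y\<in>B. \<Oplus>a\<in>supp f.
      f a \<otimes> (h (inv\<^bsub>G\<^esub> a \<otimes>\<^bsub>G\<^esub> y) \<otimes> k (inv\<^bsub>G\<^esub> y \<otimes>\<^bsub>G\<^esub> x)))"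
  proof (rule R.finsum_cong'[OF HOL.refl])
    fix y assume y: "y \<in> B"
    then have "(f \<otimes>\<^bsub>RG\<^esub> h) y = (\<Oplus>a\<in>supp f. f a \<otimes> h (inv\<^bsub>G\<^esub> a \<otimes>\<^bsub>G\<^esub> y))"
      using f h finf suppG BG by (intro mult_eq) auto
    then have "(f \<otimes>\<^bsub>RG\<^esub> h) y \<otimes> k (inv\<^bsub>G\<^esub> y \<otimes>\<^bsub>G\<^esub> x)
        = (\<Oplus>a\<in>supp f. f a \<otimes> h (inv\<^bsub>G\<^esub> a \<otimes>\<^bsub>G\<^esub> y) \<otimes> k (inv\<^bsub>G\<^esub> y \<otimes>\<^bsub>G\<^esub> x))"
      using y f h k x finf suppG BG
      by (auto intro!: R.finsum_ldistr coeff_closed[OF f] coeff_closed[OF h] coeff_closed[OF k])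
    also have "\<dots> = (\<Oplus>a\<in>supp f.
        f a \<otimes> (h (inv\<^bsub>G\<^esub> a \<otimes>\<^bsub>G\<^esub> y) \<otimes> k (inv\<^bsub>G\<^esub> y \<otimes>\<^bsub>G\<^esub> x)))"
      using y closed by (intro R.finsum_cong' HOL.refl) (auto simp: R.m_assoc)
    finally show "(f \<otimes>\<^bsub>RG\<^esub> h) y \<otimes> k (inv\<^bsub>G\<^esub> y \<otimes>\<^bsub>G\<^esub> x) = \<dots>" .
  qed (use closed in \<open>auto intro!: R.finsum_closed\<close>)
  also have "\<dots> = (\<Oplus>a\<in>supp f. \<Oplus>y\<in>B.
      f a \<otimes> (h (inv\<^bsub>G\<^esub> a \<otimes>\<^bsub>G\<^esub> y) \<otimes> k (inv\<^bsub>G\<^esub> y \<otimes>\<^bsub>G\<^esub> x)))"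
    using closed by (intro R.finsum_swap finB finf) auto
  also have "\<dots> = (\<Oplus>a\<in>supp f. f a \<otimes> (h \<otimes>\<^bsub>RG\<^esub> k) (inv\<^bsub>G\<^esub> a \<otimes>\<^bsub>G\<^esub> x))"
  proof (rule R.finsum_cong'[OF HOL.refl])
    fix a assume a: "a \<in> supp f"
    then have aG: "a \<in> carrier G" using suppG by auto
    let ?t = "\<lambda>y. inv\<^bsub>G\<^esub> a \<otimes>\<^bsub>G\<^esub> y"
    have inj: "inj_on ?t B"
      using aG BG by (meson G.inj_on_cmult G.inv_closed inj_on_subset)
    have tB: "?t ` B \<subseteq> carrier G"
      using aG BG by auto
    \<comment> \<open>The translated set is a legitimate index set for \<open>h\<close>: an element
      b of its support is the translate of a b, which lies in \<open>B\<close>.\<close>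
    have "supp h \<subseteq> ?t ` B"
    proof
      fix b assume b: "b \<in> supp h"
      then have "b = ?t (a \<otimes>\<^bsub>G\<^esub> b)"
        using aG by (simp add: supp_def G.m_assoc[symmetric])
      moreover have "a \<otimes>\<^bsub>G\<^esub> b \<in> B"
        using a b by (auto simp: B_def)
      ultimately show "b \<in> ?t ` B" by blast
    qed
    then have "(h \<otimes>\<^bsub>RG\<^esub> k) (?t x)
        = (\<Oplus>b\<in>?t ` B. h b \<otimes> k (inv\<^bsub>G\<^esub> b \<otimes>\<^bsub>G\<^esub> (?t x)))"
      using h k finB tB aG x by (intro mult_eq) auto
    also have "\<dots> = (\<Oplus>y\<in>B. h (?t y) \<otimes> k (inv\<^bsub>G\<^esub> (?t y) \<otimes>\<^bsub>G\<^esub> (?t x)))"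
      using inj h k tB aG x by (intro R.finsum_reindex) (auto intro!: R.m_closed coeff_closed[OF h] coeff_closed[OF k])
    also have "\<dots> = (\<Oplus>y\<in>B. h (?t y) \<otimes> k (inv\<^bsub>G\<^esub> y \<otimes>\<^bsub>G\<^esub> x))"
    proof (rule R.finsum_cong'[OF HOL.refl])
      fix y assume y: "y \<in> B"
      then have yG: "y \<in> carrier G" using BG by auto
      have "inv\<^bsub>G\<^esub> (?t y) \<otimes>\<^bsub>G\<^esub> (?t x) = inv\<^bsub>G\<^esub> y \<otimes>\<^bsub>G\<^esub> (a \<otimes>\<^bsub>G\<^esub> (inv\<^bsub>G\<^esub> a \<otimes>\<^bsub>G\<^esub> x))"
        using aG yG x by (simp add: G.inv_mult_group G.m_assoc)
      also have "\<dots> = inv\<^bsub>G\<^esub> y \<otimes>\<^bsub>G\<^esub> x"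
        using aG x by (simp add: G.m_assoc[symmetric])
      finally show "h (?t y) \<otimes> k (inv\<^bsub>G\<^esub> (?t y) \<otimes>\<^bsub>G\<^esub> (?t x)) = h (?t y) \<otimes> k (inv\<^bsub>G\<^esub> y \<otimes>\<^bsub>G\<^esub> x)"
        by simp
    qed (use a closed in auto)
    finally have "(h \<otimes>\<^bsub>RG\<^esub> k) (?t x) = (\<Oplus>y\<in>B. h (?t y) \<otimes> k (inv\<^bsub>G\<^esub> y \<otimes>\<^bsub>G\<^esub> x))" .
    then show "(\<Oplus>y\<in>B. f a \<otimes> (h (?t y) \<otimes> k (inv\<^bsub>G\<^esub> y \<otimes>\<^bsub>G\<^esub> x)))
        = f a \<otimes> (h \<otimes>\<^bsub>RG\<^esub> k) (?t x)"
      using f a closed finB aG by (auto intro!: R.finsum_rdistr[symmetric] coeff_closed[OF f])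
  qed (use x suppG in \<open>auto intro!: R.m_closed coeff_closed[OF f]
      coeff_closed[OF mult_closed[OF h k]]\<close>)
  also have "\<dots> = (f \<otimes>\<^bsub>RG\<^esub> (h \<otimes>\<^bsub>RG\<^esub> k)) x"
    using f h k x finf suppG by (intro mult_eq[symmetric]) (auto simp: mult_closed)
  finally show "(f \<otimes>\<^bsub>RG\<^esub> h \<otimes>\<^bsub>RG\<^esub> k) x = (f \<otimes>\<^bsub>RG\<^esub> (h \<otimes>\<^bsub>RG\<^esub> k)) x" .
qed (use f h k in \<open>simp_all add: mult_closed\<close>)

lemma add_eq: "x \<in> carrier G \<Longrightarrow> (f \<oplus>\<^bsub>RG\<^esub> h) x = f x \<oplus> h x"
  by (simp add: group_algebra_def)

lemma add_closed:
  assumes f: "f \<in> carrier RG" and h: "h \<in> carrier RG"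
  shows "f \<oplus>\<^bsub>RG\<^esub> h \<in> carrier RG"
proof -
  have "supp (f \<oplus>\<^bsub>RG\<^esub> h) \<subseteq> supp f \<union> supp h"
    by (auto simp: supp_def add_eq)
  then have "finite (supp (f \<oplus>\<^bsub>RG\<^esub> h))"
    using f h by (meson carrier_iff finite_UnI finite_subset)
  moreover have "f \<oplus>\<^bsub>RG\<^esub> h \<in> carrier G \<rightarrow>\<^sub>E carrier R"
    using f h by (auto simp: group_algebra_def)
  ultimately show ?thesis
    by (simp add: carrier_iff)
qed

lemma single_closed: "c \<in> carrier R \<Longrightarrow> ga_single R G c g \<in> carrier RG"
proof -
  assume "c \<in> carrier R"
  moreover have "supp (ga_single R G c g) \<subseteq> {g}"
    by (auto simp: supp_def ga_single_def)
  ultimately show ?thesis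
    by (auto simp: carrier_iff ga_single_def intro: finite_subset)
qed

lemma single_mult_eq:
  assumes "c \<in> carrier R" and "g \<in> carrier G" and "h \<in> carrier RG" and "x \<in> carrier G"
  shows "(ga_single R G c g \<otimes>\<^bsub>RG\<^esub> h) x = c \<otimes> h (inv\<^bsub>G\<^esub> g \<otimes>\<^bsub>G\<^esub> x)"
proof -
  have "(ga_single R G c g \<otimes>\<^bsub>RG\<^esub> h) x
      = (\<Oplus>y\<in>{g}. ga_single R G c g y \<otimes> h (inv\<^bsub>G\<^esub> y \<otimes>\<^bsub>G\<^esub> x))"
    using assms by (intro mult_eq single_closed) (auto simp: supp_def ga_single_def)
  then show ?thesis
    using assms by (simp add: ga_single_def coeff_closed)
qed

lemma single_mult_single:
  assumes "c \<in> carrier R" and "d \<in> carrier R" and "g \<in> carrier G" and "h \<in> carrier G"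
  shows "ga_single R G c g \<otimes>\<^bsub>RG\<^esub> ga_single R G d h = ga_single R G (c \<otimes> d) (g \<otimes>\<^bsub>G\<^esub> h)"
proof (rule eqI)
  fix x assume x: "x \<in> carrier G"
  then have "inv\<^bsub>G\<^esub> g \<otimes>\<^bsub>G\<^esub> x = h \<longleftrightarrow> x = g \<otimes>\<^bsub>G\<^esub> h"
    using assms by (metis G.inv_closed G.inv_solve_left)
  moreover have "(ga_single R G c g \<otimes>\<^bsub>RG\<^esub> ga_single R G d h) x
      = c \<otimes> ga_single R G d h (inv\<^bsub>G\<^esub> g \<otimes>\<^bsub>G\<^esub> x)"
    using assms x by (intro single_mult_eq single_closed)
  ultimately show "(ga_single R G c g \<otimes>\<^bsub>RG\<^esub> ga_single R G d h) x
      = ga_single R G (c \<otimes> d) (g \<otimes>\<^bsub>G\<^esub> h) x"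
    using assms x by (simp add: ga_single_def)
qed (use assms in \<open>simp_all add: mult_closed single_closed\<close>)

lemma one_eq_single: "\<one>\<^bsub>RG\<^esub> = ga_single R G \<one> \<one>\<^bsub>G\<^esub>"
  by (simp add: group_algebra_def ga_single_def)

text \<open>Convolution sums over the left factor, so this is not the mirror image of
  \<open>single_mult_eq\<close>: the sum has many indices, of which only y = x contributes. The set
  \<open>?B\<close> includes x in case x is outside the support.\<close>

lemma mult_single_one_eq:
  assumes "c \<in> carrier R" and "f \<in> carrier RG" and "x \<in> carrier G"
  shows "(f \<otimes>\<^bsub>RG\<^esub> ga_single R G c \<one>\<^bsub>G\<^esub>) x = f x \<otimes> c"
proof -
  let ?B = "insert x (supp f)"
  have B: "finite ?B" "?B \<subseteq> carrier G"
    using assms by (auto simp: carrier_iff supp_def)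
  then have "(f \<otimes>\<^bsub>RG\<^esub> ga_single R G c \<one>\<^bsub>G\<^esub>) x
      = (\<Oplus>y\<in>?B. f y \<otimes> ga_single R G c \<one>\<^bsub>G\<^esub> (inv\<^bsub>G\<^esub> y \<otimes>\<^bsub>G\<^esub> x))"
    using assms by (intro mult_eq single_closed) auto
  also have "\<dots> = (\<Oplus>y\<in>?B. if x = y then f y \<otimes> c else \<zero>)"
  proof (rule R.finsum_cong'[OF HOL.refl])
    fix y assume "y \<in> ?B"
    then have y: "y \<in> carrier G" using B by auto
    then have "inv\<^bsub>G\<^esub> y \<otimes>\<^bsub>G\<^esub> x = \<one>\<^bsub>G\<^esub> \<longleftrightarrow> x = y"
      using assms(3) by (metis G.inv_closed G.inv_solve_left G.one_closed G.r_one)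
    then show "f y \<otimes> ga_single R G c \<one>\<^bsub>G\<^esub> (inv\<^bsub>G\<^esub> y \<otimes>\<^bsub>G\<^esub> x) = (if x = y then f y \<otimes> c else \<zero>)"
      using y assms by (auto simp: ga_single_def coeff_closed)
  qed (use assms B in \<open>auto intro!: coeff_closed[OF assms(2)]\<close>)
  also have "\<dots> = f x \<otimes> c"
    using assms B by (intro R.finsum_singleton)
      (auto intro!: coeff_closed[OF assms(2)])
  finally show ?thesis .
qed

lemma ring_group_algebra: "ring RG"
proof (rule ringI)
  show "abelian_group RG"
  proof (rule abelian_groupI)
    have zero: "\<zero>\<^bsub>RG\<^esub> x = \<zero>" if "x \<in> carrier G" for x
      using that by (simp add: group_algebra_def)
    then have "supp \<zero>\<^bsub>RG\<^esub> = {}"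
      by (auto simp: supp_def)
    then show zero_closed: "\<zero>\<^bsub>RG\<^esub> \<in> carrier RG"
      by (simp add: carrier_iff) (simp add: group_algebra_def)
    fix f assume f: "f \<in> carrier RG"
    show "\<zero>\<^bsub>RG\<^esub> \<oplus>\<^bsub>RG\<^esub> f = f"
      by (rule eqI) (simp_all add: f add_closed zero_closed add_eq zero coeff_closed)
    let ?g = "\<lambda>x\<in>carrier G. \<ominus> f x"
    have "supp ?g \<subseteq> supp f"
      by (auto simp: supp_def)
    then have g: "?g \<in> carrier RG"
      using f by (auto simp: carrier_iff intro: finite_subset)
    have "?g \<oplus>\<^bsub>RG\<^esub> f = \<zero>\<^bsub>RG\<^esub>"
      by (rule eqI) (simp_all add: f g add_closed zero_closed add_eq zero coeff_closed R.l_neg)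
    with g show "\<exists>g\<in>carrier RG. g \<oplus>\<^bsub>RG\<^esub> f = \<zero>\<^bsub>RG\<^esub>"
      by blast
    fix h assume h: "h \<in> carrier RG"
    show "f \<oplus>\<^bsub>RG\<^esub> h \<in> carrier RG"
      using f h by (rule add_closed)
    show "f \<oplus>\<^bsub>RG\<^esub> h = h \<oplus>\<^bsub>RG\<^esub> f"
      by (rule eqI) (simp_all add: f h add_closed add_eq coeff_closed R.a_comm)
    fix k assume k: "k \<in> carrier RG"
    show "f \<oplus>\<^bsub>RG\<^esub> h \<oplus>\<^bsub>RG\<^esub> k = f \<oplus>\<^bsub>RG\<^esub> (h \<oplus>\<^bsub>RG\<^esub> k)"
      by (rule eqI) (simp_all add: f h k add_closed add_eq coeff_closed R.a_assoc)
  qed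
  show "monoid RG"
  proof (rule monoidI)
    show "\<one>\<^bsub>RG\<^esub> \<in> carrier RG"
      by (simp add: one_eq_single single_closed)
    fix f assume f: "f \<in> carrier RG"
    show "\<one>\<^bsub>RG\<^esub> \<otimes>\<^bsub>RG\<^esub> f = f" "f \<otimes>\<^bsub>RG\<^esub> \<one>\<^bsub>RG\<^esub> = f"
      by (rule eqI; simp add: f one_eq_single single_closed mult_closed single_mult_eq
          mult_single_one_eq coeff_closed)+
  qed (simp_all add: mult_closed mult_assoc)
  fix f h k assume f: "f \<in> carrier RG" and h: "h \<in> carrier RG" and k: "k \<in> carrier RG"
  show "(f \<oplus>\<^bsub>RG\<^esub> h) \<otimes>\<^bsub>RG\<^esub> k = f \<otimes>\<^bsub>RG\<^esub> k \<oplus>\<^bsub>RG\<^esub> h \<otimes>\<^bsub>RG\<^esub> k"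
  proof (rule eqI)
    fix x assume x: "x \<in> carrier G"
    let ?B = "supp f \<union> supp h"
    have B: "finite ?B" "?B \<subseteq> carrier G" "supp f \<subseteq> ?B" "supp h \<subseteq> ?B" "supp (f \<oplus>\<^bsub>RG\<^esub> h) \<subseteq> ?B"
      using f h by (auto simp: carrier_iff supp_def add_eq)
    have "((f \<oplus>\<^bsub>RG\<^esub> h) \<otimes>\<^bsub>RG\<^esub> k) x
        = (\<Oplus>y\<in>?B. (f \<oplus>\<^bsub>RG\<^esub> h) y \<otimes> k (inv\<^bsub>G\<^esub> y \<otimes>\<^bsub>G\<^esub> x))"
      using B f h k x by (intro mult_eq add_closed)
    also have "\<dots> = (\<Oplus>y\<in>?B. f y \<otimes> k (inv\<^bsub>G\<^esub> y \<otimes>\<^bsub>G\<^esub> x) \<oplus> h y \<otimes> k (inv\<^bsub>G\<^esub> y \<otimes>\<^bsub>G\<^esub> x))"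
    proof (rule R.finsum_cong'[OF HOL.refl])
      fix y assume "y \<in> ?B"
      then have y: "y \<in> carrier G" using B by blast
      then show "(f \<oplus>\<^bsub>RG\<^esub> h) y \<otimes> k (inv\<^bsub>G\<^esub> y \<otimes>\<^bsub>G\<^esub> x)
          = f y \<otimes> k (inv\<^bsub>G\<^esub> y \<otimes>\<^bsub>G\<^esub> x) \<oplus> h y \<otimes> k (inv\<^bsub>G\<^esub> y \<otimes>\<^bsub>G\<^esub> x)"
        using f h k x by (simp add: add_eq R.l_distr coeff_closed)
    qed (use B(2) f h k x in \<open>auto intro!: R.a_closed R.m_closed
      coeff_closed[OF f] coeff_closed[OF h] coeff_closed[OF k]\<close>)
    also have "\<dots> = (\<Oplus>y\<in>?B. f y \<otimes> k (inv\<^bsub>G\<^esub> y \<otimes>\<^bsub>G\<^esub> x)) \<oplus> (\<Oplus>y\<in>?B. h y \<otimes> k (inv\<^bsub>G\<^esub> y \<otimes>\<^bsub>G\<^esub> x))"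
      using B(2) f h k x by (intro R.finsum_addf)
        (auto intro!: R.m_closed coeff_closed[OF f] coeff_closed[OF h] coeff_closed[OF k])
    also have "\<dots> = (f \<otimes>\<^bsub>RG\<^esub> k) x \<oplus> (h \<otimes>\<^bsub>RG\<^esub> k) x"
      using B f h k x by (simp only: mult_eq[of f k ?B x] mult_eq[of h k ?B x])
    finally show "((f \<oplus>\<^bsub>RG\<^esub> h) \<otimes>\<^bsub>RG\<^esub> k) x = (f \<otimes>\<^bsub>RG\<^esub> k \<oplus>\<^bsub>RG\<^esub> h \<otimes>\<^bsub>RG\<^esub> k) x"
      using x by (simp add: add_eq)
  qed (simp_all add: f h k add_closed mult_closed)
  show "k \<otimes>\<^bsub>RG\<^esub> (f \<oplus>\<^bsub>RG\<^esub> h) = k \<otimes>\<^bsub>RG\<^esub> f \<oplus>\<^bsub>RG\<^esub> k \<otimes>\<^bsub>RG\<^esub> h"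
  proof (rule eqI)
    fix x assume x: "x \<in> carrier G"
    let ?B = "supp k"
    have B: "finite ?B" "?B \<subseteq> carrier G"
      using k by (auto simp: carrier_iff supp_def)
    have "(k \<otimes>\<^bsub>RG\<^esub> (f \<oplus>\<^bsub>RG\<^esub> h)) x
        = (\<Oplus>y\<in>?B. k y \<otimes> (f \<oplus>\<^bsub>RG\<^esub> h) (inv\<^bsub>G\<^esub> y \<otimes>\<^bsub>G\<^esub> x))"
      using B f h k x by (intro mult_eq add_closed subset_refl)
    also have "\<dots> = (\<Oplus>y\<in>?B. k y \<otimes> f (inv\<^bsub>G\<^esub> y \<otimes>\<^bsub>G\<^esub> x) \<oplus> k y \<otimes> h (inv\<^bsub>G\<^esub> y \<otimes>\<^bsub>G\<^esub> x))"
    proof (rule R.finsum_cong'[OF HOL.refl])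
      fix y assume "y \<in> ?B"
      then have y: "y \<in> carrier G" using B by blast
      then show "k y \<otimes> (f \<oplus>\<^bsub>RG\<^esub> h) (inv\<^bsub>G\<^esub> y \<otimes>\<^bsub>G\<^esub> x)
          = k y \<otimes> f (inv\<^bsub>G\<^esub> y \<otimes>\<^bsub>G\<^esub> x) \<oplus> k y \<otimes> h (inv\<^bsub>G\<^esub> y \<otimes>\<^bsub>G\<^esub> x)"
        using f h k x by (simp add: add_eq R.r_distr coeff_closed)
    qed (use B(2) f h k x in \<open>auto intro!: R.a_closed R.m_closed
      coeff_closed[OF f] coeff_closed[OF h] coeff_closed[OF k]\<close>)
    also have "\<dots> = (\<Oplus>y\<in>?B. k y \<otimes> f (inv\<^bsub>G\<^esub> y \<otimes>\<^bsub>G\<^esub> x)) \<oplus> (\<Oplus>y\<in>?B. k y \<otimes> h (inv\<^bsub>G\<^esub> y \<otimes>\<^bsub>G\<^esub> x))"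
      using B(2) f h k x by (intro R.finsum_addf)
        (auto intro!: R.m_closed coeff_closed[OF f] coeff_closed[OF h] coeff_closed[OF k])
    also have "\<dots> = (k \<otimes>\<^bsub>RG\<^esub> f) x \<oplus> (k \<otimes>\<^bsub>RG\<^esub> h) x"
      using B f h k x by (simp only: mult_eq[of k f ?B x] mult_eq[of k h ?B x] subset_refl)
    finally show "(k \<otimes>\<^bsub>RG\<^esub> (f \<oplus>\<^bsub>RG\<^esub> h)) x = (k \<otimes>\<^bsub>RG\<^esub> f \<oplus>\<^bsub>RG\<^esub> k \<otimes>\<^bsub>RG\<^esub> h) x"
      using x by (simp add: add_eq)
  qed (simp_all add: f h k add_closed mult_closed)
qed

end

section \<open>Power series over a noncommutative ring\<close>

locale power_series = W: ring W for W :: "('w, 'm) ring_scheme" (structure)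
begin

abbreviation "PS \<equiv> power_series_ring W"

lemma carrier_PS: "f \<in> carrier PS \<longleftrightarrow> (\<forall>n. f n \<in> carrier W)"
  by (auto simp: power_series_ring_def)

lemma coeff_mult: "(f \<otimes>\<^bsub>PS\<^esub> g) n = (\<Oplus>j\<in>{..n}. f j \<otimes> g (n - j))"
  by (simp add: power_series_ring_def)

lemma coeff_add: "(f \<oplus>\<^bsub>PS\<^esub> g) n = f n \<oplus> g n"
  by (simp add: power_series_ring_def)

lemma mult_closed: "f \<in> carrier PS \<Longrightarrow> g \<in> carrier PS \<Longrightarrow> f \<otimes>\<^bsub>PS\<^esub> g \<in> carrier PS"
  by (auto simp: carrier_PS coeff_mult intro!: W.finsum_closed)

definition truncate :: "nat \<Rightarrow> (nat \<Rightarrow> 'w) \<Rightarrow> nat \<Rightarrow> 'w" where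
  "truncate n f = (\<lambda>k. if k \<le> n then f k else \<zero>)"

lemma truncate_le: "k \<le> n \<Longrightarrow> truncate n f k = f k"
  by (simp add: truncate_def)

lemma truncate_up: "f \<in> carrier PS \<Longrightarrow> truncate n f \<in> up W"
  unfolding up_def truncate_def by (auto simp: carrier_PS intro!: exI[of _ n])

lemma coeff_mult_cong:
  assumes "f \<in> carrier PS" and "g \<in> carrier PS"
    and "\<And>k. k \<le> n \<Longrightarrow> f' k = f k" and "\<And>k. k \<le> n \<Longrightarrow> g' k = g k"
  shows "(f \<otimes>\<^bsub>PS\<^esub> g) n = (f' \<otimes>\<^bsub>PS\<^esub> g') n"
  unfolding coeff_mult using assms
  by (intro W.finsum_cong') (auto simp: carrier_PS)

text \<open>The \<open>n\<close>-th coefficient of a product depends only on coefficients up to \<open>n\<close>, so associativity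
  is inherited from polynomials.\<close>

lemma mult_assoc:
  assumes "f \<in> carrier PS" and "g \<in> carrier PS" and "h \<in> carrier PS"
  shows "f \<otimes>\<^bsub>PS\<^esub> g \<otimes>\<^bsub>PS\<^esub> h = f \<otimes>\<^bsub>PS\<^esub> (g \<otimes>\<^bsub>PS\<^esub> h)"
proof
  fix n
  let ?t = "truncate n"
  have up: "?t f \<in> up W" "?t g \<in> up W" "?t h \<in> up W"
    using assms by (simp_all add: truncate_up)
  have mult: "a \<otimes>\<^bsub>UP W\<^esub> b = a \<otimes>\<^bsub>PS\<^esub> b" "a \<otimes>\<^bsub>PS\<^esub> b \<in> up W" if "a \<in> up W" "b \<in> up W" for a b
    using that W.up_mult_closed[of a b] by (simp_all add: UP_def power_series_ring_def)
  have "?t f \<otimes>\<^bsub>UP W\<^esub> ?t g \<otimes>\<^bsub>UP W\<^esub> ?t h = ?t f \<otimes>\<^bsub>UP W\<^esub> (?t g \<otimes>\<^bsub>UP W\<^esub> ?t h)"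
    using up by (intro UP_ring.UP_m_assoc[OF UP_ring.intro[OF W.ring_axioms]]) (simp_all add: UP_def)
  then have assoc: "?t f \<otimes>\<^bsub>PS\<^esub> ?t g \<otimes>\<^bsub>PS\<^esub> ?t h = ?t f \<otimes>\<^bsub>PS\<^esub> (?t g \<otimes>\<^bsub>PS\<^esub> ?t h)"
    by (simp add: mult up)
  \<comment> \<open>A product of truncations may have degree above n, but it agrees with the full
    product through degree n, which is all that coefficient n of the outer product sees.\<close>
  have low: "(?t a \<otimes>\<^bsub>PS\<^esub> ?t b) k = (a \<otimes>\<^bsub>PS\<^esub> b) k"
    if "a \<in> carrier PS" "b \<in> carrier PS" "k \<le> n" for a b k
    using that by (intro coeff_mult_cong[symmetric]) (simp_all add: truncate_le)
  have "(f \<otimes>\<^bsub>PS\<^esub> g \<otimes>\<^bsub>PS\<^esub> h) n = (?t f \<otimes>\<^bsub>PS\<^esub> ?t g \<otimes>\<^bsub>PS\<^esub> ?t h) n"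
    by (rule coeff_mult_cong) (use assms in \<open>simp_all add: mult_closed low truncate_le\<close>)
  also have "\<dots> = (f \<otimes>\<^bsub>PS\<^esub> (g \<otimes>\<^bsub>PS\<^esub> h)) n"
    unfolding assoc
    by (rule coeff_mult_cong[symmetric]) (use assms in \<open>simp_all add: mult_closed low truncate_le\<close>)
  finally show "(f \<otimes>\<^bsub>PS\<^esub> g \<otimes>\<^bsub>PS\<^esub> h) n = (f \<otimes>\<^bsub>PS\<^esub> (g \<otimes>\<^bsub>PS\<^esub> h)) n" .
qed

lemma const_closed: "a \<in> carrier W \<Longrightarrow> ps_const W a \<in> carrier PS"
  by (simp add: carrier_PS ps_const_def)

lemma coeff_const_mult:
  assumes "a \<in> carrier W" and "f \<in> carrier PS"
  shows "(ps_const W a \<otimes>\<^bsub>PS\<^esub> f) n = a \<otimes> f n"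
proof -
  have "(ps_const W a \<otimes>\<^bsub>PS\<^esub> f) n = (\<Oplus>j\<in>{..n}. if 0 = j then a \<otimes> f (n - j) else \<zero>)"
    unfolding coeff_mult ps_const_def using assms
    by (intro W.finsum_cong') (auto simp: carrier_PS)
  also have "\<dots> = a \<otimes> f n"
    using assms by (subst W.finsum_singleton) (auto simp: carrier_PS)
  finally show ?thesis .
qed

lemma coeff_mult_const:
  assumes "a \<in> carrier W" and "f \<in> carrier PS"
  shows "(f \<otimes>\<^bsub>PS\<^esub> ps_const W a) n = f n \<otimes> a"
proof -
  have "(f \<otimes>\<^bsub>PS\<^esub> ps_const W a) n = (\<Oplus>j\<in>{..n}. if n = j then f j \<otimes> a else \<zero>)"
    unfolding coeff_mult ps_const_def using assms
    by (intro W.finsum_cong') (auto simp: carrier_PS)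
  also have "\<dots> = f n \<otimes> a"
    using assms by (subst W.finsum_singleton) (auto simp: carrier_PS)
  finally show ?thesis .
qed

lemma one_eq_const: "\<one>\<^bsub>PS\<^esub> = ps_const W \<one>"
  by (simp add: power_series_ring_def ps_const_def)

lemma ring_PS: "ring PS"
proof (rule ringI)
  show "abelian_group PS"
  proof (rule abelian_groupI)
    show "\<zero>\<^bsub>PS\<^esub> \<in> carrier PS"
      by (simp add: power_series_ring_def)
    fix f assume f: "f \<in> carrier PS"
    show "\<zero>\<^bsub>PS\<^esub> \<oplus>\<^bsub>PS\<^esub> f = f"
      using f by (intro ext) (simp add: carrier_PS coeff_add, simp add: carrier_PS power_series_ring_def)
    show "\<exists>g\<in>carrier PS. g \<oplus>\<^bsub>PS\<^esub> f = \<zero>\<^bsub>PS\<^esub>"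
      using f by (intro bexI[of _ "\<lambda>n. \<ominus> f n"]) (auto simp: power_series_ring_def W.l_neg Pi_def)
    fix g assume g: "g \<in> carrier PS"
    show "f \<oplus>\<^bsub>PS\<^esub> g \<in> carrier PS"
      using f g by (simp add: carrier_PS coeff_add)
    show "f \<oplus>\<^bsub>PS\<^esub> g = g \<oplus>\<^bsub>PS\<^esub> f"
      using f g by (intro ext) (simp add: carrier_PS coeff_add W.a_comm)
    fix h assume h: "h \<in> carrier PS"
    show "f \<oplus>\<^bsub>PS\<^esub> g \<oplus>\<^bsub>PS\<^esub> h = f \<oplus>\<^bsub>PS\<^esub> (g \<oplus>\<^bsub>PS\<^esub> h)"
      using f g h by (intro ext) (simp add: carrier_PS coeff_add W.a_assoc)
  qed
  show "monoid PS"
  proof (rule monoidI)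
    show "\<one>\<^bsub>PS\<^esub> \<in> carrier PS"
      by (simp add: one_eq_const const_closed)
    fix f assume f: "f \<in> carrier PS"
    show "\<one>\<^bsub>PS\<^esub> \<otimes>\<^bsub>PS\<^esub> f = f" "f \<otimes>\<^bsub>PS\<^esub> \<one>\<^bsub>PS\<^esub> = f"
      using f by (auto simp: one_eq_const coeff_const_mult coeff_mult_const carrier_PS)
  qed (simp_all add: mult_closed mult_assoc)
  fix f g h assume "f \<in> carrier PS" "g \<in> carrier PS" "h \<in> carrier PS"
  then have closed: "f n \<in> carrier W" "g n \<in> carrier W" "h n \<in> carrier W" for n
    by (simp_all add: carrier_PS)
  show "(f \<oplus>\<^bsub>PS\<^esub> g) \<otimes>\<^bsub>PS\<^esub> h = f \<otimes>\<^bsub>PS\<^esub> h \<oplus>\<^bsub>PS\<^esub> g \<otimes>\<^bsub>PS\<^esub> h"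
    by (intro ext) (simp add: coeff_mult coeff_add W.l_distr closed W.finsum_addf)
  show "h \<otimes>\<^bsub>PS\<^esub> (f \<oplus>\<^bsub>PS\<^esub> g) = h \<otimes>\<^bsub>PS\<^esub> f \<oplus>\<^bsub>PS\<^esub> h \<otimes>\<^bsub>PS\<^esub> g"
    by (intro ext) (simp add: coeff_mult coeff_add W.r_distr closed W.finsum_addf)
qed

lemma const_hom: "ps_const W \<in> ring_hom W PS"
proof (rule ring_hom_memI)
  fix a b assume "a \<in> carrier W" "b \<in> carrier W"
  then show "ps_const W (a \<otimes> b) = ps_const W a \<otimes>\<^bsub>PS\<^esub> ps_const W b"
    by (intro ext) (simp add: coeff_const_mult const_closed, simp add: ps_const_def)
  show "ps_const W (a \<oplus> b) = ps_const W a \<oplus>\<^bsub>PS\<^esub> ps_const W b"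
    by (intro ext) (simp add: coeff_add ps_const_def)
qed (simp_all add: const_closed one_eq_const)

lemma uinv_closed: "ps_uinv W \<in> carrier PS"
  by (simp add: carrier_PS ps_uinv_def)

lemma coeff_uinv_mult:
  assumes "f \<in> carrier PS"
  shows "(ps_uinv W \<otimes>\<^bsub>PS\<^esub> f) n = (if n = 0 then \<zero> else f (n - 1))"
    and "(f \<otimes>\<^bsub>PS\<^esub> ps_uinv W) n = (if n = 0 then \<zero> else f (n - 1))"
proof -
  have "(ps_uinv W \<otimes>\<^bsub>PS\<^esub> f) n = (\<Oplus>j\<in>{..n}. if 1 = j then f (n - j) else \<zero>)"
    unfolding coeff_mult ps_uinv_def using assms
    by (intro W.finsum_cong') (auto simp: carrier_PS)
  also have "\<dots> = (if n = 0 then \<zero> else f (n - 1))"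
    using assms W.finsum_singleton[of 1 "{..n}" "\<lambda>j. f (n - j)"] by (auto simp: carrier_PS)
  finally show "(ps_uinv W \<otimes>\<^bsub>PS\<^esub> f) n = (if n = 0 then \<zero> else f (n - 1))" .
  \<comment> \<open>For n = 0 truncated subtraction makes n - 1 match j = 0; the inner conditional
    keeps that term zero.\<close>
  have "(f \<otimes>\<^bsub>PS\<^esub> ps_uinv W) n = (\<Oplus>j\<in>{..n}. if n - 1 = j then (if n = 0 then \<zero> else f j) else \<zero>)"
    unfolding coeff_mult ps_uinv_def using assms
    by (intro W.finsum_cong') (auto simp: carrier_PS)
  also have "\<dots> = (if n = 0 then \<zero> else f (n - 1))"
    using assms W.finsum_singleton[of "n - 1" "{..n}" "\<lambda>j. if n = 0 then \<zero> else f j"]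
    by (auto simp: carrier_PS)
  finally show "(f \<otimes>\<^bsub>PS\<^esub> ps_uinv W) n = (if n = 0 then \<zero> else f (n - 1))" .
qed

lemma uinv_central: "f \<in> carrier PS \<Longrightarrow> ps_uinv W \<otimes>\<^bsub>PS\<^esub> f = f \<otimes>\<^bsub>PS\<^esub> ps_uinv W"
  by (intro ext) (simp add: coeff_uinv_mult)

lemma coeff_const_uinv_pow:
  assumes "a \<in> carrier W"
  shows "(ps_const W a \<otimes>\<^bsub>PS\<^esub> ps_uinv W [^]\<^bsub>PS\<^esub> m) n = (if n = m then a else \<zero>)"
proof -
  interpret PS: ring PS by (rule ring_PS)
  show ?thesis
  proof (induction m arbitrary: n)
    case 0
    then show ?case
      using assms by (simp add: const_closed) (simp add: ps_const_def)
  next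
    case (Suc m)
    have "(ps_const W a \<otimes>\<^bsub>PS\<^esub> ps_uinv W [^]\<^bsub>PS\<^esub> Suc m) n
        = (ps_const W a \<otimes>\<^bsub>PS\<^esub> ps_uinv W [^]\<^bsub>PS\<^esub> m \<otimes>\<^bsub>PS\<^esub> ps_uinv W) n"
      using assms by (simp add: PS.m_assoc const_closed uinv_closed)
    also have "\<dots> = (if n = Suc m then a else \<zero>)"
      using assms by (subst coeff_uinv_mult(2)) (auto simp: Suc.IH const_closed uinv_closed)
    finally show ?case .
  qed
qed

lemma coeff_uinv_pow_mult:
  assumes "f \<in> carrier PS"
  shows "(ps_uinv W [^]\<^bsub>PS\<^esub> m \<otimes>\<^bsub>PS\<^esub> f) n = (if n < m then \<zero> else f (n - m))"
proof -
  interpret PS: ring PS by (rule ring_PS)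
  show ?thesis
  proof (induction m arbitrary: n)
    case 0
    then show ?case
      using assms by simp
  next
    case (Suc m)
    have "ps_uinv W [^]\<^bsub>PS\<^esub> Suc m \<otimes>\<^bsub>PS\<^esub> f = ps_uinv W \<otimes>\<^bsub>PS\<^esub> (ps_uinv W [^]\<^bsub>PS\<^esub> m \<otimes>\<^bsub>PS\<^esub> f)"
      using assms uinv_central[of "ps_uinv W [^]\<^bsub>PS\<^esub> m"] by (simp add: PS.m_assoc[symmetric] uinv_closed)
    then show ?case
      using assms by (auto simp: coeff_uinv_mult(1) Suc.IH uinv_closed)
  qed
qed

lemma frac_closed: "a \<in> carrier W \<Longrightarrow> ps_frac W m a \<in> carrier PS"
  by (simp add: carrier_PS ps_frac_def)

text \<open>Splitting off the first term of the geometric series, from the left and from the right.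
  Both forms are kept because together they make 1 plus the series a two-sided inverse of 1 -
  x.\<close>

lemma frac_eq:
  assumes a: "a \<in> carrier W" and m: "0 < m"
  defines "x \<equiv> ps_const W a \<otimes>\<^bsub>PS\<^esub> ps_uinv W [^]\<^bsub>PS\<^esub> m"
  shows "ps_frac W m a = x \<oplus>\<^bsub>PS\<^esub> x \<otimes>\<^bsub>PS\<^esub> ps_frac W m a"
    and "ps_frac W m a = x \<oplus>\<^bsub>PS\<^esub> ps_frac W m a \<otimes>\<^bsub>PS\<^esub> x"
proof -
  interpret PS: ring PS by (rule ring_PS)
  let ?f = "ps_frac W m a"
  have f: "?f \<in> carrier PS" and v: "ps_uinv W [^]\<^bsub>PS\<^esub> m \<in> carrier PS" and c: "ps_const W a \<in> carrier PS"
    using a by (simp_all add: frac_closed const_closed uinv_closed)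
  have vf: "(ps_uinv W [^]\<^bsub>PS\<^esub> m \<otimes>\<^bsub>PS\<^esub> ?f) n = (if n < m then \<zero> else ?f (n - m))" for n
    using f by (rule coeff_uinv_pow_mult)
  have fv: "?f \<otimes>\<^bsub>PS\<^esub> ps_uinv W [^]\<^bsub>PS\<^esub> m = ps_uinv W [^]\<^bsub>PS\<^esub> m \<otimes>\<^bsub>PS\<^esub> ?f"
    using f uinv_central[of ?f] by (intro PS.group_commutes_pow[symmetric] uinv_closed) simp
  have vc: "ps_const W a \<otimes>\<^bsub>PS\<^esub> ps_uinv W [^]\<^bsub>PS\<^esub> m = ps_uinv W [^]\<^bsub>PS\<^esub> m \<otimes>\<^bsub>PS\<^esub> ps_const W a"
    using c uinv_central[of "ps_const W a"] by (intro PS.group_commutes_pow[symmetric] uinv_closed) simp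
  \<comment> \<open>The series starts at exponent 1, so its coefficient at 0 vanishes; hence at n =
    m the term \<open>a\<close> comes from the monomial x alone, and for n > m from the
    product.\<close>
  have step: "?f n = (if n = m then a else \<zero>) \<oplus> (if n < m then \<zero> else a \<otimes> ?f (n - m))"
    "?f n = (if n = m then a else \<zero>) \<oplus> (if n < m then \<zero> else ?f (n - m) \<otimes> a)" for n
  proof -
    consider "n < m" | "n = m" | k where "n = k + m" "0 < k"
      by (metis add.commute less_imp_add_positive linorder_neqE_nat)
    then have "?f n = (if n = m then a else \<zero>) \<oplus> (if n < m then \<zero> else a \<otimes> ?f (n - m))
      \<and> ?f n = (if n = m then a else \<zero>) \<oplus> (if n < m then \<zero> else ?f (n - m) \<otimes> a)"
    proof cases
      case 1
      then show ?thesis by (auto simp: ps_frac_def dest: dvd_imp_le)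
    next
      case 2
      then show ?thesis using a m by (simp add: ps_frac_def W.nat_pow_eone)
    next
      case 3
      then show ?thesis
        using a m W.group_commutes_pow[of a a] by (auto simp: ps_frac_def W.nat_pow_Suc2)
    qed
    then show "?f n = (if n = m then a else \<zero>) \<oplus> (if n < m then \<zero> else a \<otimes> ?f (n - m))"
      "?f n = (if n = m then a else \<zero>) \<oplus> (if n < m then \<zero> else ?f (n - m) \<otimes> a)"
      by blast+
  qed
  have coeff_x: "x n = (if n = m then a else \<zero>)" for n
    unfolding x_def using a by (rule coeff_const_uinv_pow)
  show "?f = x \<oplus>\<^bsub>PS\<^esub> x \<otimes>\<^bsub>PS\<^esub> ?f"
  proof
    fix n
    have "x \<otimes>\<^bsub>PS\<^esub> ?f = ps_const W a \<otimes>\<^bsub>PS\<^esub> (ps_uinv W [^]\<^bsub>PS\<^esub> m \<otimes>\<^bsub>PS\<^esub> ?f)"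
      unfolding x_def using c f v by (simp add: PS.m_assoc)
    then have "(x \<otimes>\<^bsub>PS\<^esub> ?f) n = (if n < m then \<zero> else a \<otimes> ?f (n - m))"
      using a f v by (simp add: coeff_const_mult vf)
    then show "?f n = (x \<oplus>\<^bsub>PS\<^esub> x \<otimes>\<^bsub>PS\<^esub> ?f) n"
      using step(1)[of n] by (simp add: coeff_add coeff_x)
  qed
  show "?f = x \<oplus>\<^bsub>PS\<^esub> ?f \<otimes>\<^bsub>PS\<^esub> x"
  proof
    fix n
    have "?f \<otimes>\<^bsub>PS\<^esub> x = ?f \<otimes>\<^bsub>PS\<^esub> ps_uinv W [^]\<^bsub>PS\<^esub> m \<otimes>\<^bsub>PS\<^esub> ps_const W a"
      unfolding x_def vc using c f v by (simp add: PS.m_assoc)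
    then have "(?f \<otimes>\<^bsub>PS\<^esub> x) n = (if n < m then \<zero> else ?f (n - m) \<otimes> a)"
      using a f v unfolding fv by (simp add: coeff_mult_const vf)
    then show "?f n = (x \<oplus>\<^bsub>PS\<^esub> ?f \<otimes>\<^bsub>PS\<^esub> x) n"
      using step(2)[of n] by (simp add: coeff_add coeff_x)
  qed
qed

end

section \<open>The identities in an abstract ring\<close>

text \<open>For noncommutative rings the \<open>algebra\<close> method does not know the right unit law.\<close>

lemmas (in ring) r_one_algebra
  [algebra ring "ring.zero R" "ring.add R" "a_inv R" "a_minus R" "monoid.one R" "monoid.mult R"] = r_one

lemmas (in ring) expand = a_minus_def l_distr r_distr l_minus r_minus minus_add minus_minus m_assoc a_assoc

text \<open>The two equations for \<open>U\<close> make 1 + U the inverse of 1 - x, and an element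
  commuting with an invertible element commutes with its inverse.\<close>

lemma (in ring) commute_geometric:
  assumes "a \<in> carrier R" and "x \<in> carrier R" and "U \<in> carrier R"
    and "U = x \<oplus> x \<otimes> U" and "U = x \<oplus> U \<otimes> x" and "a \<otimes> x = x \<otimes> a"
  shows "a \<otimes> U = U \<otimes> a"
proof -
  note closed = assms(1-3)
  have inv: "(\<one> \<oplus> U) \<otimes> (\<one> \<ominus> x) = \<one>" "(\<one> \<ominus> x) \<otimes> (\<one> \<oplus> U) = \<one>"
  proof -
    have "(\<one> \<oplus> U) \<otimes> (\<one> \<ominus> x) = \<one> \<oplus> U \<ominus> (x \<oplus> U \<otimes> x)"
      using closed by algebra
    then show "(\<one> \<oplus> U) \<otimes> (\<one> \<ominus> x) = \<one>"
      using closed unfolding assms(5)[symmetric] by algebra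
    have "(\<one> \<ominus> x) \<otimes> (\<one> \<oplus> U) = \<one> \<oplus> U \<ominus> (x \<oplus> x \<otimes> U)"
      using closed by algebra
    then show "(\<one> \<ominus> x) \<otimes> (\<one> \<oplus> U) = \<one>"
      using closed unfolding assms(4)[symmetric] by algebra
  qed
  have com: "a \<otimes> (\<one> \<ominus> x) = (\<one> \<ominus> x) \<otimes> a"
    using closed assms(6) by (simp add: expand)
  \<comment> \<open>The factor (1 - x)(1 + U) = 1 is inserted on the right; \<open>a\<close> can
    then be exchanged with 1 - x and the left pair cancels.\<close>
  have "(\<one> \<oplus> U) \<otimes> a = (\<one> \<oplus> U) \<otimes> (a \<otimes> (\<one> \<ominus> x)) \<otimes> (\<one> \<oplus> U)"
    using closed by (simp add: m_assoc inv)
  also have "\<dots> = a \<otimes> (\<one> \<oplus> U)"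
    using closed unfolding com by (simp add: m_assoc[symmetric] inv)
  finally have "a \<oplus> U \<otimes> a = a \<oplus> a \<otimes> U"
    using closed by algebra
  then show ?thesis
    using closed by simp
qed

lemma (in ring) add_minus_cancel_left: "a \<in> carrier R \<Longrightarrow> b \<in> carrier R \<Longrightarrow> a \<oplus> b \<ominus> a = b"
  by algebra

text \<open>Used to multiply a two-term relation by inverses on both sides. The bracketing keeps
  each outer factor next to the factor it cancels or absorbs.\<close>

lemma (in ring) sandwich_distr:
  assumes "h \<in> carrier R" "a \<in> carrier R" "b \<in> carrier R" "c \<in> carrier R" "d \<in> carrier R" "g \<in> carrier R"
  shows "h \<otimes> (a \<otimes> b \<oplus> c \<otimes> d) \<otimes> g = (h \<otimes> a) \<otimes> (b \<otimes> g) \<oplus> (h \<otimes> c) \<otimes> (d \<otimes> g)"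
  using assms by (simp add: l_distr r_distr m_assoc)

text \<open>\<open>T'\<close> and \<open>r\<close> are the inverses of \<open>T\<close> and \<open>Q\<close>; the equations for \<open>U\<close>, \<open>V\<close> and \<open>F\<close> characterise
  them as \<open>x / (1 - x)\<close>, \<open>y / (1 - y)\<close> and \<open>x y / (1 - x y)\<close>.\<close>

locale skein_series = ring +
  fixes T T' E x y U V F Q r z
  assumes closed: "T \<in> carrier R" "T' \<in> carrier R" "E \<in> carrier R" "x \<in> carrier R"
      "y \<in> carrier R" "U \<in> carrier R" "V \<in> carrier R" "F \<in> carrier R"
      "Q \<in> carrier R" "r \<in> carrier R" "z \<in> carrier R"
    and T_T': "T \<otimes> T' = \<one>" and T'_T: "T' \<otimes> T = \<one>"
    and y_eq: "y = T \<otimes> x \<otimes> T" and xy: "x \<otimes> y = y \<otimes> x"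
    and E_eq: "E = \<one> \<ominus> r \<otimes> (T \<ominus> T')"
    and E_T': "E \<otimes> T' = z \<otimes> E"
    and central: "\<And>a. a \<in> carrier R \<Longrightarrow> Q \<otimes> a = a \<otimes> Q" "\<And>a. a \<in> carrier R \<Longrightarrow> r \<otimes> a = a \<otimes> r"
    and Q_r: "Q \<otimes> r = \<one>"
    and U: "U = x \<oplus> x \<otimes> U" "U = x \<oplus> U \<otimes> x"
    and V: "V = y \<oplus> y \<otimes> V" "V = y \<oplus> V \<otimes> y"
    and F: "F = x \<otimes> y \<oplus> x \<otimes> y \<otimes> F" "F = x \<otimes> y \<oplus> F \<otimes> (x \<otimes> y)"
begin

section \<open>Skein relation, commutation and partial fractions\<close>

abbreviation "D \<equiv> \<one> \<ominus> E"

lemma T'_eq: "T' = T \<ominus> Q \<otimes> D"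
proof -
  have "Q \<otimes> D = Q \<otimes> r \<otimes> (T \<ominus> T')"
    using closed unfolding E_eq by algebra
  then show ?thesis
    using closed Q_r by algebra
qed

lemma r_T_diff: "r \<otimes> (T \<ominus> T') = D"
  using closed unfolding E_eq by algebra

lemma y_T': "y \<otimes> T' = T \<otimes> x"
  using closed T_T' by (simp add: y_eq m_assoc)

lemma T'_y: "T' \<otimes> y = x \<otimes> T"
  using closed T'_T by (simp add: y_eq m_assoc[symmetric])

text \<open>Both T (x y) = T (y x) and (y x) T are the word T x T x T, up to the commutation of x
  and y. Conjugation gives the statement for \<open>T'\<close>, and \<open>E\<close> is built from
  \<open>T\<close> and \<open>T'\<close> with the central coefficient \<open>r\<close>.\<close>

lemma xy_commute:
  shows "T \<otimes> (x \<otimes> y) = x \<otimes> y \<otimes> T" and "T' \<otimes> (x \<otimes> y) = x \<otimes> y \<otimes> T'"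
    and "E \<otimes> (x \<otimes> y) = x \<otimes> y \<otimes> E"
proof -
  have "T \<otimes> (x \<otimes> y) = y \<otimes> x \<otimes> T"
    using closed by (simp add: y_eq m_assoc)
  then show T: "T \<otimes> (x \<otimes> y) = x \<otimes> y \<otimes> T"
    by (simp add: xy)
  have "T' \<otimes> (x \<otimes> y) = T' \<otimes> ((x \<otimes> y) \<otimes> T) \<otimes> T'"
    using closed T_T' by (simp add: m_assoc)
  also have "\<dots> = (T' \<otimes> T) \<otimes> (x \<otimes> y) \<otimes> T'"
    using closed by (simp only: T[symmetric] m_assoc m_closed)
  finally show T': "T' \<otimes> (x \<otimes> y) = x \<otimes> y \<otimes> T'"
    using closed T'_T by simp
  let ?p = "x \<otimes> y"
  have p: "?p \<in> carrier R"
    using closed by simp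
  have "E \<otimes> ?p = ?p \<ominus> r \<otimes> (T \<otimes> ?p \<ominus> T' \<otimes> ?p)"
    using closed p unfolding E_eq by algebra
  also have "\<dots> = ?p \<ominus> (r \<otimes> ?p) \<otimes> (T \<ominus> T')"
    using closed p unfolding T T' by algebra
  also have "\<dots> = ?p \<otimes> E"
    using closed p unfolding central(2)[OF p] E_eq by algebra
  finally show "E \<otimes> ?p = ?p \<otimes> E" .
qed

text \<open>\<open>commute_geometric\<close> is applied twice: once to x and y against each series,
  then to \<open>U\<close> as an element commuting with y.\<close>

lemma commute_U_V: "x \<otimes> U = U \<otimes> x" "y \<otimes> U = U \<otimes> y" "x \<otimes> V = V \<otimes> x" "y \<otimes> V = V \<otimes> y"
    "U \<otimes> V = V \<otimes> U"
proof -
  show U': "x \<otimes> U = U \<otimes> x" "y \<otimes> U = U \<otimes> y" and V': "x \<otimes> V = V \<otimes> x" "y \<otimes> V = V \<otimes> y"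
    using commute_geometric[of _ x U] commute_geometric[of _ y V] closed U V xy by metis+
  show "U \<otimes> V = V \<otimes> U"
    using commute_geometric[of U y V] closed V U' by metis
qed

lemma commute_F: "T \<otimes> F = F \<otimes> T" "T' \<otimes> F = F \<otimes> T'" "E \<otimes> F = F \<otimes> E" "U \<otimes> F = F \<otimes> U" "V \<otimes> F = F \<otimes> V"
proof -
  have p: "x \<otimes> y \<in> carrier R"
    using closed by simp
  have F: "a \<otimes> F = F \<otimes> a" if "a \<in> carrier R" "a \<otimes> (x \<otimes> y) = x \<otimes> y \<otimes> a" for a
    using commute_geometric[OF that(1) p closed(8) F that(2)] .
  show "T \<otimes> F = F \<otimes> T" "T' \<otimes> F = F \<otimes> T'" "E \<otimes> F = F \<otimes> E"
    by (auto intro!: F closed xy_commute)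
  have "U \<otimes> (x \<otimes> y) = x \<otimes> y \<otimes> U" "V \<otimes> (x \<otimes> y) = x \<otimes> y \<otimes> V"
    using closed commute_U_V by (metis m_assoc)+
  then show "U \<otimes> F = F \<otimes> U" "V \<otimes> F = F \<otimes> V"
    by (auto intro!: F closed)
qed

text \<open>Partial fractions. With p = x y, the equations x U = U - x and y V = V - y give (1 - p)
  U V = p (U + V + 1); multiplication by 1 + F, the inverse of 1 - p, turns the factor p into
  \<open>F\<close>.\<close>

lemma U_V: "U \<otimes> V = F \<otimes> (U \<oplus> V \<oplus> \<one>)"
proof -
  let ?p = "x \<otimes> y"
  have p: "?p \<in> carrier R"
    using closed by simp
  have 1: "?p \<otimes> (U \<otimes> V) = (U \<ominus> x) \<otimes> (V \<ominus> y)"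
  proof -
    have "?p \<otimes> (U \<otimes> V) = x \<otimes> (y \<otimes> U) \<otimes> V"
      using closed by (simp add: m_assoc)
    also have "\<dots> = (x \<otimes> U) \<otimes> (y \<otimes> V)"
      using closed by (simp add: m_assoc commute_U_V(2))
    also have "x \<otimes> U = x \<oplus> x \<otimes> U \<ominus> x"
      using closed by algebra
    also have "x \<oplus> x \<otimes> U \<ominus> x = U \<ominus> x"
      by (simp add: U(1)[symmetric])
    also have "y \<otimes> V = y \<oplus> y \<otimes> V \<ominus> y"
      using closed by algebra
    also have "\<dots> = V \<ominus> y"
      by (simp add: V(1)[symmetric])
    finally show ?thesis .
  qed
  have 2: "?p \<otimes> U = U \<otimes> y \<ominus> ?p"
  proof -
    have "?p \<otimes> U = (x \<oplus> x \<otimes> U) \<otimes> y \<ominus> ?p"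
      using closed by (simp add: l_distr m_assoc commute_U_V(2) p) algebra
    then show ?thesis
      by (simp add: U(1)[symmetric])
  qed
  have 3: "?p \<otimes> V = x \<otimes> V \<ominus> ?p"
  proof -
    have "?p \<otimes> V = x \<otimes> (y \<oplus> y \<otimes> V) \<ominus> ?p"
      using closed by algebra
    then show ?thesis
      by (simp add: V(1)[symmetric])
  qed
  have 4: "U \<otimes> V \<ominus> ?p \<otimes> (U \<otimes> V) = ?p \<otimes> (U \<oplus> V \<oplus> \<one>)"
  proof -
    have "U \<otimes> V \<ominus> ?p \<otimes> (U \<otimes> V) = U \<otimes> y \<oplus> x \<otimes> V \<ominus> ?p"
      using closed unfolding 1 by algebra
    also have "\<dots> = ?p \<otimes> U \<oplus> ?p \<otimes> V \<oplus> ?p"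
      using closed unfolding 2 3 by algebra
    finally show ?thesis
      using closed by algebra
  qed
  let ?W = "U \<otimes> V" and ?S = "U \<oplus> V \<oplus> \<one>"
  have W: "?W \<in> carrier R" "?S \<in> carrier R"
    using closed by simp_all
  \<comment> \<open>The added and subtracted terms are equal because p + F p = F; written this way,
    the right side contains the factors (1 + F)(1 - p).\<close>
  have "?W = ?W \<oplus> F \<otimes> ?W \<ominus> (?p \<oplus> F \<otimes> ?p) \<otimes> ?W"
    using W closed p unfolding F(2)[symmetric] by algebra
  also have "\<dots> = (\<one> \<oplus> F) \<otimes> (?W \<ominus> ?p \<otimes> ?W)"
    using W closed p by (simp add: expand; algebra?)
  also have "\<dots> = (?p \<oplus> F \<otimes> ?p) \<otimes> ?S"
    using W closed p unfolding 4 by (simp add: l_distr m_assoc)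
  finally show ?thesis
    unfolding F(2)[symmetric] .
qed

section \<open>Moving T past the geometric series\<close>

lemma geometric_inverse:
  "(U \<oplus> \<one>) \<otimes> (\<one> \<ominus> x) = \<one>" "(\<one> \<ominus> x) \<otimes> (U \<oplus> \<one>) = \<one>"
  "(V \<oplus> \<one>) \<otimes> (\<one> \<ominus> y) = \<one>" "(\<one> \<ominus> y) \<otimes> (V \<oplus> \<one>) = \<one>"
  "x \<otimes> (U \<oplus> \<one>) = U" "(U \<oplus> \<one>) \<otimes> x = U" "y \<otimes> (V \<oplus> \<one>) = V" "(V \<oplus> \<one>) \<otimes> y = V"
proof -
  show 1: "x \<otimes> (U \<oplus> \<one>) = U" "(U \<oplus> \<one>) \<otimes> x = U" "y \<otimes> (V \<oplus> \<one>) = V" "(V \<oplus> \<one>) \<otimes> y = V"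
    using closed U V by (simp_all add: l_distr r_distr a_comm)
  have "(U \<oplus> \<one>) \<otimes> (\<one> \<ominus> x) = U \<oplus> \<one> \<ominus> (U \<oplus> \<one>) \<otimes> x"
    "(\<one> \<ominus> x) \<otimes> (U \<oplus> \<one>) = U \<oplus> \<one> \<ominus> x \<otimes> (U \<oplus> \<one>)"
    "(V \<oplus> \<one>) \<otimes> (\<one> \<ominus> y) = V \<oplus> \<one> \<ominus> (V \<oplus> \<one>) \<otimes> y"
    "(\<one> \<ominus> y) \<otimes> (V \<oplus> \<one>) = V \<oplus> \<one> \<ominus> y \<otimes> (V \<oplus> \<one>)"
    using closed by algebra+
  moreover have "a \<oplus> \<one> \<ominus> a = \<one>" if "a \<in> carrier R" for a
    using that by algebra
  ultimately show "(U \<oplus> \<one>) \<otimes> (\<one> \<ominus> x) = \<one>" "(\<one> \<ominus> x) \<otimes> (U \<oplus> \<one>) = \<one>"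
      "(V \<oplus> \<one>) \<otimes> (\<one> \<ominus> y) = \<one>" "(\<one> \<ominus> y) \<otimes> (V \<oplus> \<one>) = \<one>"
    using closed by (simp_all add: 1)
qed

text \<open>From T (1 - x) = (1 - y) T + Q y D, with the inverse of 1 - y multiplied on the left and
  that of 1 - x on the right. The correction keeps \<open>V\<close> rather than V + 1 because (V +
  1) y = V.\<close>

lemma V_T: "(V \<oplus> \<one>) \<otimes> T = T \<otimes> (U \<oplus> \<one>) \<oplus> Q \<otimes> (V \<otimes> D \<otimes> (U \<oplus> \<one>))"
proof -
  have T: "T \<otimes> (\<one> \<ominus> x) = (\<one> \<ominus> y) \<otimes> T \<oplus> Q \<otimes> (y \<otimes> D)"
  proof -
    have "T \<otimes> (\<one> \<ominus> x) = T \<ominus> y \<otimes> (T \<ominus> Q \<otimes> D)"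
      using closed y_T' T'_eq by algebra
    also have "\<dots> = (\<one> \<ominus> y) \<otimes> T \<oplus> (y \<otimes> Q) \<otimes> D"
      using closed by algebra
    finally show ?thesis
      using closed by (simp add: central(1)[of y, symmetric] m_assoc)
  qed
  have "(V \<oplus> \<one>) \<otimes> T = (V \<oplus> \<one>) \<otimes> (T \<otimes> (\<one> \<ominus> x)) \<otimes> (U \<oplus> \<one>)"
    using closed by (simp add: m_assoc geometric_inverse)
  also have "\<dots> = ((V \<oplus> \<one>) \<otimes> (\<one> \<ominus> y)) \<otimes> (T \<otimes> (U \<oplus> \<one>))
      \<oplus> ((V \<oplus> \<one>) \<otimes> Q) \<otimes> ((y \<otimes> D) \<otimes> (U \<oplus> \<one>))"
    using closed unfolding T by (intro sandwich_distr) simp_all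
  also have "(V \<oplus> \<one>) \<otimes> Q = Q \<otimes> (V \<oplus> \<one>)"
    using closed by (simp add: central(1))
  also have "Q \<otimes> (V \<oplus> \<one>) \<otimes> ((y \<otimes> D) \<otimes> (U \<oplus> \<one>)) = Q \<otimes> (((V \<oplus> \<one>) \<otimes> y) \<otimes> D \<otimes> (U \<oplus> \<one>))"
    using closed by (simp only: m_assoc m_closed a_closed one_closed minus_closed)
  finally show ?thesis
    using closed by (simp add: geometric_inverse)
qed

text \<open>Mirror image of \<open>V_T\<close>, starting from \<open>T' y = x T\<close> instead of
  \<open>y T' = T x\<close>.\<close>

lemma T_V: "T \<otimes> (V \<oplus> \<one>) = (U \<oplus> \<one>) \<otimes> T \<oplus> Q \<otimes> ((U \<oplus> \<one>) \<otimes> D \<otimes> V)"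
proof -
  have T: "(\<one> \<ominus> x) \<otimes> T = T \<otimes> (\<one> \<ominus> y) \<oplus> Q \<otimes> (D \<otimes> y)"
  proof -
    have "(\<one> \<ominus> x) \<otimes> T = T \<ominus> (T \<ominus> Q \<otimes> D) \<otimes> y"
      using closed T'_y T'_eq by algebra
    then show ?thesis
      using closed by algebra
  qed
  have "T \<otimes> (V \<oplus> \<one>) = (U \<oplus> \<one>) \<otimes> ((\<one> \<ominus> x) \<otimes> T) \<otimes> (V \<oplus> \<one>)"
    using closed by (simp add: m_assoc[symmetric] geometric_inverse)
  also have "\<dots> = ((U \<oplus> \<one>) \<otimes> T) \<otimes> ((\<one> \<ominus> y) \<otimes> (V \<oplus> \<one>))
      \<oplus> ((U \<oplus> \<one>) \<otimes> Q) \<otimes> ((D \<otimes> y) \<otimes> (V \<oplus> \<one>))"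
    using closed unfolding T by (intro sandwich_distr) simp_all
  also have "(U \<oplus> \<one>) \<otimes> Q = Q \<otimes> (U \<oplus> \<one>)"
    using closed by (simp add: central(1))
  also have "Q \<otimes> (U \<oplus> \<one>) \<otimes> ((D \<otimes> y) \<otimes> (V \<oplus> \<one>)) = Q \<otimes> ((U \<oplus> \<one>) \<otimes> D \<otimes> (y \<otimes> (V \<oplus> \<one>)))"
    using closed by (simp only: m_assoc m_closed a_closed one_closed minus_closed)
  finally show ?thesis
    using closed by (simp add: geometric_inverse)
qed

text \<open>Right multiplication of \<open>V_T\<close> by x: the left side becomes (V + 1) T x = (V
  + 1) y T', and (U + 1) x = U on the right.\<close>

lemma V_T': "V \<otimes> T' = T \<otimes> U \<oplus> Q \<otimes> (V \<otimes> D \<otimes> U)"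
proof -
  have "V \<otimes> T' = (V \<oplus> \<one>) \<otimes> (y \<otimes> T')"
    using closed by (simp add: m_assoc[symmetric] geometric_inverse)
  also have "\<dots> = (V \<oplus> \<one>) \<otimes> T \<otimes> x"
    using closed by (simp add: y_T' m_assoc)
  also have "\<dots> = T \<otimes> ((U \<oplus> \<one>) \<otimes> x) \<oplus> Q \<otimes> (V \<otimes> D \<otimes> ((U \<oplus> \<one>) \<otimes> x))"
    using closed unfolding V_T by (simp only: l_distr m_assoc m_closed a_closed one_closed minus_closed)
  finally show ?thesis
    by (simp add: geometric_inverse)
qed

lemma T'_V: "T' \<otimes> V = U \<otimes> T \<oplus> Q \<otimes> (U \<otimes> D \<otimes> V)"
proof -
  have "T' \<otimes> V = (T' \<otimes> y) \<otimes> (V \<oplus> \<one>)"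
    using closed by (simp add: m_assoc geometric_inverse)
  also have "\<dots> = x \<otimes> (T \<otimes> (V \<oplus> \<one>))"
    using closed by (simp add: T'_y m_assoc)
  also have "\<dots> = (x \<otimes> (U \<oplus> \<one>)) \<otimes> T \<oplus> (x \<otimes> Q) \<otimes> ((U \<oplus> \<one>) \<otimes> D \<otimes> V)"
    using closed r_distr[of "(U \<oplus> \<one>) \<otimes> T" "Q \<otimes> ((U \<oplus> \<one>) \<otimes> D \<otimes> V)" x] unfolding T_V
    by (simp only: m_assoc m_closed a_closed one_closed minus_closed)
  also have "x \<otimes> Q = Q \<otimes> x"
    using closed by (simp add: central(1))
  also have "Q \<otimes> x \<otimes> ((U \<oplus> \<one>) \<otimes> D \<otimes> V) = Q \<otimes> ((x \<otimes> (U \<oplus> \<one>)) \<otimes> D \<otimes> V)"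
    using closed by (simp only: m_assoc m_closed a_closed one_closed minus_closed)
  finally show ?thesis
    by (simp add: geometric_inverse)
qed

section \<open>Expansion of the two identities\<close>

lemma Q_r_cancel: "a \<in> carrier R \<Longrightarrow> Q \<otimes> (r \<otimes> a) = a" "a \<in> carrier R \<Longrightarrow> r \<otimes> (Q \<otimes> a) = a"
  using closed Q_r central(1)[of r] by (simp_all add: m_assoc[symmetric])

lemma r_left: "a \<in> carrier R \<Longrightarrow> b \<in> carrier R \<Longrightarrow> a \<otimes> (r \<otimes> b) = r \<otimes> (a \<otimes> b)"
  using closed central(2)[of a] by (simp add: m_assoc[symmetric])

text \<open>Since \<open>m_assoc\<close> nests products to the right, the commutation of
  \<open>F\<close> is needed with a trailing factor \<open>b\<close> in order to pull
  \<open>F\<close> to the front of a longer product.\<close>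

lemma F_left: "b \<in> carrier R \<Longrightarrow> T \<otimes> (F \<otimes> b) = F \<otimes> (T \<otimes> b)"
   "b \<in> carrier R \<Longrightarrow> T' \<otimes> (F \<otimes> b) = F \<otimes> (T' \<otimes> b)"
   "b \<in> carrier R \<Longrightarrow> E \<otimes> (F \<otimes> b) = F \<otimes> (E \<otimes> b)"
   "b \<in> carrier R \<Longrightarrow> U \<otimes> (F \<otimes> b) = F \<otimes> (U \<otimes> b)"
   "b \<in> carrier R \<Longrightarrow> V \<otimes> (F \<otimes> b) = F \<otimes> (V \<otimes> b)"
  using closed commute_F by (simp_all add: m_assoc[symmetric])

lemma T_E: "T \<otimes> E = E \<otimes> T"
proof -
  have "T \<otimes> E = T \<ominus> r \<otimes> (T \<otimes> T) \<oplus> r \<otimes> (T \<otimes> T')"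
    using closed unfolding E_eq by (simp add: expand r_left)
  moreover have "E \<otimes> T = T \<ominus> r \<otimes> (T \<otimes> T) \<oplus> r \<otimes> (T' \<otimes> T)"
    using closed unfolding E_eq by (simp add: expand)
  ultimately show ?thesis
    by (simp add: T_T' T'_T)
qed

text \<open>The partial fraction formula multiplied by \<open>E\<close>, the form in which it enters
  both identities.\<close>

lemma E_V_U: "E \<otimes> (V \<otimes> U) = F \<otimes> (E \<otimes> U) \<oplus> F \<otimes> (E \<otimes> V) \<oplus> F \<otimes> E"
  using closed by (simp add: commute_U_V(5)[symmetric] U_V F_left commute_F r_distr)

text \<open>By \<open>V_T'\<close> the three terms containing no \<open>F\<close> and at least one
  of \<open>U\<close>, \<open>V\<close> add up to E V U. Partial fractions expand this, and the
  mixed terms with \<open>F\<close> cancel all of it except F E. The term F E is completed to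
  \<open>F\<close> by F (T - T') r = F - F E; what remains is F^2 and -r^2.\<close>

lemma first_identity:
  "(E \<otimes> V \<ominus> T \<otimes> r \<ominus> F) \<otimes> (E \<otimes> U \<oplus> T' \<otimes> r \<ominus> F) = F \<oplus> F \<otimes> F \<ominus> r \<otimes> r"
proof -
  have product: "(a \<ominus> t \<ominus> F) \<otimes> (b \<oplus> t' \<ominus> F)
      = a \<otimes> b \<oplus> a \<otimes> t' \<ominus> a \<otimes> F \<ominus> t \<otimes> b \<ominus> t \<otimes> t' \<oplus> t \<otimes> F \<ominus> F \<otimes> b \<ominus> F \<otimes> t' \<oplus> F \<otimes> F"
    if "a \<in> carrier R" "b \<in> carrier R" "t \<in> carrier R" "t' \<in> carrier R" for a b t t'
    using that closed(8) by (simp add: expand) algebra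
  \<comment> \<open>Each monomial becomes a single letter, so that only addition is left. The names
    are products of a = E V, b = E U, t = T r, t' = T' r, \<open>F\<close> and \<open>E\<close>;
    \<open>evu\<close> is E V U.\<close>
  have atoms: "ab \<oplus> at' \<ominus> aF \<ominus> tb \<ominus> tt' \<oplus> tF \<ominus> Fb \<ominus> Ft' \<oplus> FF = F \<oplus> FF \<ominus> tt'"
    if "at' = tb \<oplus> evu \<ominus> ab" and "evu = Fb \<oplus> aF \<oplus> FE" and "tF = Ft' \<oplus> (F \<ominus> FE)"
      and "ab \<in> carrier R" "aF \<in> carrier R" "tb \<in> carrier R" "tt' \<in> carrier R"
        "Fb \<in> carrier R" "Ft' \<in> carrier R" "FF \<in> carrier R" "FE \<in> carrier R"
    for ab at' aF tb tt' tF Fb Ft' FF evu FE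
  proof -
    have "ab \<oplus> at' \<ominus> aF \<ominus> tb \<ominus> tt' \<oplus> tF \<ominus> Fb \<ominus> Ft' \<oplus> FF
        = (ab \<oplus> at' \<ominus> tb \<ominus> aF \<ominus> Fb) \<oplus> (tF \<ominus> Ft') \<oplus> (FF \<ominus> tt')"
      if "at' \<in> carrier R" "tF \<in> carrier R"
      using that \<open>ab \<in> carrier R\<close> \<open>aF \<in> carrier R\<close> \<open>tb \<in> carrier R\<close> \<open>tt' \<in> carrier R\<close>
        \<open>Fb \<in> carrier R\<close> \<open>Ft' \<in> carrier R\<close> \<open>FF \<in> carrier R\<close> by algebra
    moreover have "ab \<oplus> at' = tb \<oplus> evu"
      using that(4-) closed(8) unfolding that(1,2) by algebra
    moreover have "tb \<oplus> evu \<ominus> tb = evu"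
      using that(4-) closed(8) unfolding that(2) by (simp add: add_minus_cancel_left)
    moreover have "evu \<ominus> aF = Fb \<oplus> FE"
      using that(4-) closed(8) unfolding that(2) by algebra
    moreover have "Fb \<oplus> FE \<ominus> Fb = FE"
      using that(4-) by (simp add: add_minus_cancel_left)
    moreover have "tF \<ominus> Ft' = F \<ominus> FE"
      using that(4-) closed(8) unfolding that(3) by (simp add: add_minus_cancel_left)
    moreover have "FE \<oplus> (F \<ominus> FE) \<oplus> (FF \<ominus> tt') = F \<oplus> FF \<ominus> tt'"
      using that(4-) closed(8) by algebra
    moreover have "at' \<in> carrier R" "tF \<in> carrier R"
      using that closed(8) by simp_all
    ultimately show ?thesis
      by simp
  qed
  have at': "E \<otimes> V \<otimes> (T' \<otimes> r) = T \<otimes> r \<otimes> (E \<otimes> U) \<oplus> E \<otimes> (V \<otimes> U) \<ominus> E \<otimes> V \<otimes> (E \<otimes> U)"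
  proof -
    have "E \<otimes> V \<otimes> (T' \<otimes> r) = r \<otimes> (E \<otimes> (V \<otimes> T'))"
      using closed central(2)[of "E \<otimes> (V \<otimes> T')"] by (simp add: m_assoc)
    also have "\<dots> = r \<otimes> ((E \<otimes> T) \<otimes> U) \<oplus> r \<otimes> ((E \<otimes> Q) \<otimes> (V \<otimes> D \<otimes> U))"
      using closed by (simp add: V_T' r_distr m_assoc)
    also have "\<dots> = (r \<otimes> T) \<otimes> (E \<otimes> U) \<oplus> r \<otimes> (Q \<otimes> (E \<otimes> (V \<otimes> D \<otimes> U)))"
      using closed unfolding T_E[symmetric] central(1)[OF closed(3), symmetric] by (simp add: m_assoc)
    also have "r \<otimes> T = T \<otimes> r"
      using closed by (simp add: central(2))
    also have "r \<otimes> (Q \<otimes> (E \<otimes> (V \<otimes> D \<otimes> U))) = E \<otimes> (V \<otimes> U) \<ominus> E \<otimes> V \<otimes> (E \<otimes> U)"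
      using closed by (simp add: Q_r_cancel expand)
    finally show ?thesis
      using closed by (simp add: a_minus_def a_assoc)
  qed
  have evu: "E \<otimes> (V \<otimes> U) = F \<otimes> (E \<otimes> U) \<oplus> E \<otimes> V \<otimes> F \<oplus> F \<otimes> E"
    using closed by (simp add: E_V_U commute_F m_assoc F_left)
  \<comment> \<open>The difference of the two terms is F r (T - T') = F D, whose part -F E cancels
    the remainder of \<open>evu\<close>.\<close>
  have tF: "T \<otimes> r \<otimes> F = F \<otimes> (T' \<otimes> r) \<oplus> (F \<ominus> F \<otimes> E)"
  proof -
    have "T \<otimes> r \<otimes> F = F \<otimes> (r \<otimes> T)"
      using closed central(2)[of F] by (simp add: central(2)[of T] m_assoc commute_F F_left)
    also have "r \<otimes> T = r \<otimes> T' \<oplus> r \<otimes> (T \<ominus> T')"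
      using closed by algebra
    also have "\<dots> = T' \<otimes> r \<oplus> D"
      using closed by (simp add: r_T_diff central(2))
    finally show ?thesis
      using closed by (simp add: expand)
  qed
  have tt': "T \<otimes> r \<otimes> (T' \<otimes> r) = r \<otimes> r"
  proof -
    have "T \<otimes> r \<otimes> (T' \<otimes> r) = T \<otimes> (T' \<otimes> r) \<otimes> r"
      using closed central(2)[of "T' \<otimes> r"] by (simp add: m_assoc)
    then show ?thesis
      using closed T_T' by (simp add: m_assoc[symmetric])
  qed
  have "(E \<otimes> V \<ominus> T \<otimes> r \<ominus> F) \<otimes> (E \<otimes> U \<oplus> T' \<otimes> r \<ominus> F)
      = F \<oplus> F \<otimes> F \<ominus> T \<otimes> r \<otimes> (T' \<otimes> r)"
    using closed by (subst product, simp_all, intro atoms[OF at' evu tF]) simp_all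
  then show ?thesis
    by (simp add: tt')
qed

text \<open>Replacing T U by means of \<open>V_T'\<close> cancels V U inside the product with
  \<open>U\<close>. Expanding (U + 1) V by partial fractions then cancels the term F (U + 1) E
  U.\<close>

lemma U_H_U:
  "(U \<oplus> \<one>) \<otimes> (V \<oplus> T \<otimes> r \<ominus> E \<otimes> F) \<otimes> U
    = r \<otimes> ((U \<oplus> \<one>) \<otimes> V \<otimes> T') \<oplus> V \<otimes> (E \<otimes> U) \<oplus> F \<otimes> (V \<otimes> (E \<otimes> U))"
proof -
  obtain G where G: "G = U \<oplus> \<one>" "G \<in> carrier R"
    using closed by simp
  have GV: "G \<otimes> V = V \<oplus> F \<otimes> G \<oplus> F \<otimes> V"
  proof -
    have "U \<otimes> V \<oplus> V = F \<otimes> (U \<oplus> V \<oplus> \<one>) \<oplus> V"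
      by (simp add: U_V)
    then show ?thesis
      using closed unfolding G by algebra
  qed
  have GF: "G \<otimes> F = F \<otimes> G"
    using closed by (simp add: G l_distr r_distr commute_F)
  have TU: "T \<otimes> U = V \<otimes> T' \<ominus> Q \<otimes> (V \<otimes> D \<otimes> U)"
    using closed unfolding V_T' by algebra
  have rTU: "r \<otimes> (T \<otimes> U) = r \<otimes> (V \<otimes> T') \<ominus> V \<otimes> U \<oplus> V \<otimes> (E \<otimes> U)"
  proof -
    have "r \<otimes> (T \<otimes> U) = r \<otimes> (V \<otimes> T') \<ominus> r \<otimes> (Q \<otimes> (V \<otimes> D \<otimes> U))"
      using closed unfolding TU by (simp add: r_distr a_minus_def r_minus)
    also have "r \<otimes> (Q \<otimes> (V \<otimes> D \<otimes> U)) = V \<otimes> U \<ominus> V \<otimes> (E \<otimes> U)"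
      using closed by (simp add: Q_r_cancel expand)
    finally show ?thesis
      using closed by (simp add: expand a_assoc)
  qed
  have "G \<otimes> (V \<oplus> T \<otimes> r \<ominus> E \<otimes> F) \<otimes> U = G \<otimes> (V \<otimes> U \<oplus> r \<otimes> (T \<otimes> U) \<ominus> F \<otimes> (E \<otimes> U))"
    using closed G(2) by (simp add: expand commute_F F_left central(2)[of T, symmetric])
  also have "\<dots> = G \<otimes> (r \<otimes> (V \<otimes> T') \<oplus> V \<otimes> (E \<otimes> U) \<ominus> F \<otimes> (E \<otimes> U))"
  proof -
    have "a \<oplus> (b \<ominus> a \<oplus> c) \<ominus> d = b \<oplus> c \<ominus> d"
      if "a \<in> carrier R" "b \<in> carrier R" "c \<in> carrier R" "d \<in> carrier R" for a b c d
      using that by algebra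
    then show ?thesis
      using closed by (simp add: rTU)
  qed
  also have "\<dots> = r \<otimes> (G \<otimes> V \<otimes> T') \<oplus> (G \<otimes> V) \<otimes> (E \<otimes> U) \<ominus> (G \<otimes> F) \<otimes> (E \<otimes> U)"
    using closed G(2) by (simp add: a_minus_def r_distr r_minus m_assoc r_left)
  \<comment> \<open>Only the product G V in front of E U is expanded next; the one in front of
    \<open>T'\<close> is left for comparison with the other side of the second identity.\<close>
  also have "\<dots> = r \<otimes> (G \<otimes> V \<otimes> T') \<oplus> ((V \<oplus> F \<otimes> G \<oplus> F \<otimes> V) \<ominus> F \<otimes> G) \<otimes> (E \<otimes> U)"
    using closed G(2) unfolding GF by (subst (2) GV) (simp add: expand a_assoc)
  also have "(V \<oplus> F \<otimes> G \<oplus> F \<otimes> V) \<ominus> F \<otimes> G = V \<oplus> F \<otimes> V"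
    using closed G(2) by algebra
  finally show ?thesis
    using closed G(2) unfolding G(1)[symmetric] by (simp add: l_distr a_assoc m_assoc)
qed

text \<open>Writing z E as E T' makes \<open>T'_V\<close> applicable to z E V, which trades E U E V
  for E V U; the remaining E U E is opened up by the definition of \<open>E\<close>. The terms r E U
  T and r z E V cancel, and partial fractions remove E V U up to F E U.\<close>

lemma E_U_E_V:
  "(E \<otimes> U \<otimes> E \<oplus> z \<otimes> E \<otimes> r \<ominus> E \<otimes> F) \<otimes> (V \<oplus> \<one>)
    = E \<otimes> U \<oplus> F \<otimes> (E \<otimes> U) \<oplus> r \<otimes> (E \<otimes> (U \<oplus> \<one>) \<otimes> T')"
proof -
  have EUEV: "E \<otimes> U \<otimes> E \<otimes> V = E \<otimes> (V \<otimes> U) \<oplus> r \<otimes> (E \<otimes> U \<otimes> T) \<ominus> r \<otimes> (z \<otimes> E \<otimes> V)"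
  proof -
    have "z \<otimes> E \<otimes> V = E \<otimes> (T' \<otimes> V)"
      using closed by (simp add: E_T'[symmetric] m_assoc)
    also have "\<dots> = E \<otimes> U \<otimes> T \<oplus> (E \<otimes> Q) \<otimes> (U \<otimes> D \<otimes> V)"
      using closed by (simp add: T'_V r_distr m_assoc)
    also have "E \<otimes> Q = Q \<otimes> E"
      using closed by (simp add: central(1))
    finally have "r \<otimes> (z \<otimes> E \<otimes> V) = r \<otimes> (E \<otimes> U \<otimes> T) \<oplus> r \<otimes> (Q \<otimes> (E \<otimes> (U \<otimes> D \<otimes> V)))"
      using closed by (simp add: r_distr m_assoc)
    also have "r \<otimes> (Q \<otimes> (E \<otimes> (U \<otimes> D \<otimes> V))) = E \<otimes> (V \<otimes> U) \<ominus> E \<otimes> U \<otimes> E \<otimes> V"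
      using closed by (simp add: Q_r_cancel expand commute_U_V(5))
    finally have eq: "r \<otimes> (z \<otimes> E \<otimes> V)
        = r \<otimes> (E \<otimes> U \<otimes> T) \<oplus> (E \<otimes> (V \<otimes> U) \<ominus> E \<otimes> U \<otimes> E \<otimes> V)" .
    have "a = c \<oplus> b \<ominus> (b \<oplus> (c \<ominus> a))" if "a \<in> carrier R" "b \<in> carrier R" "c \<in> carrier R" for a b c
      using that by algebra
    then show ?thesis
      using closed unfolding eq by simp
  qed
  \<comment> \<open>Only the second \<open>E\<close> is replaced, by 1 - r (T - T').\<close>
  have EUE: "E \<otimes> U \<otimes> E = E \<otimes> U \<ominus> r \<otimes> (E \<otimes> U \<otimes> T) \<oplus> r \<otimes> (E \<otimes> U \<otimes> T')"
  proof -
    have "E \<otimes> U \<otimes> E = E \<otimes> U \<ominus> E \<otimes> U \<otimes> D"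
      using closed by (simp add: expand) algebra
    also have "E \<otimes> U \<otimes> D = r \<otimes> (E \<otimes> U \<otimes> (T \<ominus> T'))"
      using closed by (simp add: r_T_diff[symmetric] r_left)
    finally show ?thesis
      using closed by (simp add: expand)
  qed
  have zEr: "z \<otimes> E \<otimes> r = r \<otimes> (z \<otimes> E)"
    using closed by (simp add: central(2))
  have atoms: "c \<oplus> t \<ominus> ze \<oplus> ze \<ominus> fev \<oplus> (eu \<ominus> t \<oplus> s \<oplus> k \<ominus> fe) = eu \<oplus> feu \<oplus> (s \<oplus> k)"
    if "c = feu \<oplus> fev \<oplus> fe" and "feu \<in> carrier R" "fev \<in> carrier R" "fe \<in> carrier R"
      "t \<in> carrier R" "ze \<in> carrier R" "eu \<in> carrier R" "s \<in> carrier R" "k \<in> carrier R"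
    for c t ze fev eu s k fe feu
    using that(2-) unfolding that(1) by algebra
  have "(E \<otimes> U \<otimes> E \<oplus> z \<otimes> E \<otimes> r \<ominus> E \<otimes> F) \<otimes> (V \<oplus> \<one>)
      = E \<otimes> U \<otimes> E \<otimes> V \<oplus> r \<otimes> (z \<otimes> E \<otimes> V) \<ominus> F \<otimes> (E \<otimes> V)
        \<oplus> (E \<otimes> U \<otimes> E \<oplus> r \<otimes> (z \<otimes> E) \<ominus> F \<otimes> E)"
    using closed by (simp add: zEr commute_F a_minus_def l_distr r_distr l_minus m_assoc)
  also have "\<dots> = E \<otimes> U \<oplus> F \<otimes> (E \<otimes> U) \<oplus> (r \<otimes> (E \<otimes> U \<otimes> T') \<oplus> r \<otimes> (z \<otimes> E))"
    using closed unfolding EUEV by (subst EUE, intro atoms[OF E_V_U]) simp_all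
  also have "r \<otimes> (E \<otimes> U \<otimes> T') \<oplus> r \<otimes> (z \<otimes> E) = r \<otimes> (E \<otimes> (U \<oplus> \<one>) \<otimes> T')"
    using closed by (simp add: E_T'[symmetric] l_distr r_distr)
  finally show ?thesis .
qed

text \<open>The products multiplied by Q^2 on the two sides, \<open>?A\<close> and
  \<open>?B\<close>, share all terms but one: V (U + 1) T' against V E (U + 1) T', each with
  coefficient \<open>r\<close>. So they differ by r X, and Q^2 r X = Q X = V - T U T' is the
  difference of the terms outside.\<close>

lemma second_identity:
  "(V \<oplus> T \<otimes> r \<ominus> E \<otimes> F) \<ominus> Q \<otimes> Q \<otimes> (U \<oplus> \<one>) \<otimes> (V \<oplus> T \<otimes> r \<ominus> E \<otimes> F) \<otimes> U
    = (T \<otimes> U \<otimes> T' \<oplus> T \<otimes> r \<ominus> E \<otimes> F)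
      \<ominus> Q \<otimes> Q \<otimes> V \<otimes> (E \<otimes> U \<otimes> E \<oplus> z \<otimes> E \<otimes> r \<ominus> E \<otimes> F) \<otimes> (V \<oplus> \<one>)"
proof -
  let ?H = "V \<oplus> T \<otimes> r \<ominus> E \<otimes> F" and ?K = "E \<otimes> U \<otimes> E \<oplus> z \<otimes> E \<otimes> r \<ominus> E \<otimes> F"
  let ?A = "(U \<oplus> \<one>) \<otimes> ?H \<otimes> U" and ?B = "V \<otimes> (?K \<otimes> (V \<oplus> \<one>))"
  let ?X = "V \<otimes> D \<otimes> (U \<oplus> \<one>) \<otimes> T'"
  have A: "?A \<in> carrier R" and B: "?B \<in> carrier R" and X: "?X \<in> carrier R"
    using closed by simp_all
  have VE: "?B = V \<otimes> (E \<otimes> U) \<oplus> F \<otimes> (V \<otimes> (E \<otimes> U)) \<oplus> r \<otimes> (V \<otimes> (E \<otimes> (U \<oplus> \<one>) \<otimes> T'))"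
    unfolding E_U_E_V using closed
    by (simp only: r_distr[of _ _ V] F_left r_left m_closed a_closed one_closed)
  have UV: "(U \<oplus> \<one>) \<otimes> V = V \<otimes> (U \<oplus> \<one>)"
    using closed by (simp add: l_distr r_distr commute_U_V(5))
  \<comment> \<open>Here 1 = D + E is inserted between \<open>V\<close> and U + 1.\<close>
  have "r \<otimes> ((U \<oplus> \<one>) \<otimes> V \<otimes> T') = r \<otimes> ?X \<oplus> r \<otimes> (V \<otimes> (E \<otimes> (U \<oplus> \<one>) \<otimes> T'))"
  proof -
    have "(a \<otimes> b) \<otimes> c = a \<otimes> (\<one> \<ominus> e) \<otimes> b \<otimes> c \<oplus> a \<otimes> (e \<otimes> b \<otimes> c)"
      if "a \<in> carrier R" "b \<in> carrier R" "c \<in> carrier R" "e \<in> carrier R" for a b c e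
      using that by (simp add: expand) algebra
    from this[of V "U \<oplus> \<one>" T' E] show ?thesis
      using closed unfolding UV by (simp only: r_distr[of _ _ r] m_closed a_closed one_closed minus_closed)
  qed
  then have AB: "?A = r \<otimes> ?X \<oplus> ?B"
    using closed unfolding VE U_H_U
    by (simp only: a_ac m_closed a_closed one_closed minus_closed)
  \<comment> \<open>This is \<open>V_T\<close> after cancelling the lone \<open>T\<close> on both
    sides, multiplied by \<open>T'\<close> on the right.\<close>
  have "V \<ominus> T \<otimes> U \<otimes> T' = Q \<otimes> ?X"
  proof -
    have "V \<ominus> T \<otimes> U \<otimes> T' = (V \<otimes> T \<ominus> T \<otimes> U) \<otimes> T'"
      using closed T_T' by (simp add: expand)
    also have "V \<otimes> T \<ominus> T \<otimes> U = (V \<oplus> \<one>) \<otimes> T \<ominus> T \<otimes> (U \<oplus> \<one>)"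
      using closed by algebra
    also have "\<dots> = Q \<otimes> (V \<otimes> D \<otimes> (U \<oplus> \<one>))"
      using closed by (simp add: V_T add_minus_cancel_left)
    finally show ?thesis
      using closed by (simp only: m_assoc m_closed a_closed one_closed minus_closed)
  qed
  moreover have "Q \<otimes> Q \<otimes> (r \<otimes> ?X) = Q \<otimes> ?X"
    using closed X by (simp only: m_assoc Q_r_cancel m_closed)
  ultimately have QA: "Q \<otimes> Q \<otimes> ?A = (V \<ominus> T \<otimes> U \<otimes> T') \<oplus> Q \<otimes> Q \<otimes> ?B"
    using closed X B unfolding AB by (simp only: r_distr[of _ _ "Q \<otimes> Q"] m_closed)
  have atoms: "v \<oplus> t \<ominus> e \<ominus> ((v \<ominus> w) \<oplus> b) = w \<oplus> t \<ominus> e \<ominus> b"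
    if "v \<in> carrier R" "w \<in> carrier R" "t \<in> carrier R" "e \<in> carrier R" "b \<in> carrier R" for v w t e b
    using that by algebra
  have "?H \<ominus> Q \<otimes> Q \<otimes> ?A = (T \<otimes> U \<otimes> T' \<oplus> T \<otimes> r \<ominus> E \<otimes> F) \<ominus> Q \<otimes> Q \<otimes> ?B"
    using closed B unfolding QA by (intro atoms) simp_all
  then show ?thesis
    using closed by (simp only: m_assoc m_closed a_closed one_closed minus_closed)
qed

text \<open>Here s is q. With p = x y, the equation s^2 + s'^2 = Q^2 + 2 turns the numerator into
  Q^2 p - (1 - p)^2. Division by Q^2 (1 - p)^2 gives p / (1 - p)^2 - r^2, and the first term is F (1
  + F).\<close>

lemma first_identity_fraction:
  assumes s: "s \<in> carrier R" "s' \<in> carrier R" and inverse: "s \<otimes> s' = \<one>" "s' \<otimes> s = \<one>"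
    and s'_central: "\<And>a. a \<in> carrier R \<Longrightarrow> s' \<otimes> a = a \<otimes> s'" and Q: "Q = s \<ominus> s'"
  shows "(E \<otimes> V \<ominus> T \<otimes> r \<ominus> F) \<otimes> (E \<otimes> U \<oplus> T' \<otimes> r \<ominus> F)
    = \<ominus> ((\<one> \<ominus> s \<otimes> s \<otimes> (x \<otimes> y)) \<otimes> (\<one> \<ominus> s' \<otimes> s' \<otimes> (x \<otimes> y)))
      \<otimes> inv (Q \<otimes> Q \<otimes> ((\<one> \<ominus> x \<otimes> y) \<otimes> (\<one> \<ominus> x \<otimes> y)))"
proof -
  obtain p where p: "p = x \<otimes> y" "p \<in> carrier R"
    using closed by simp
  define m where "m = \<one> \<ominus> p"
  define N where "N = \<one> \<oplus> F"
  have m: "m \<in> carrier R" and N: "N \<in> carrier R"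
    using closed p(2) by (simp_all add: m_def N_def)
  have pN: "p \<otimes> N = F"
    using closed p(2) F(1) unfolding p(1)[symmetric] by (simp add: N_def r_distr)
  have "m \<otimes> N = \<one> \<oplus> F \<ominus> p \<otimes> N"
    using closed p(2) unfolding m_def N_def by (simp add: expand) algebra
  then have mN: "m \<otimes> N = \<one>"
    using closed by (simp add: pN a_comm add_minus_cancel_left)
  have "N \<otimes> m = \<one> \<oplus> F \<ominus> (p \<oplus> F \<otimes> p)"
    using closed p(2) unfolding m_def N_def by (simp add: expand) algebra
  then have Nm: "N \<otimes> m = \<one>"
    using closed F(2) unfolding p(1)[symmetric] by (simp add: a_comm add_minus_cancel_left)
  \<comment> \<open>N is the inverse of 1 - p, so \<open>?d'\<close> is the expected inverse of the
    denominator; both orders of the product are checked, as the ring is noncommutative.\<close>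
  let ?d = "Q \<otimes> Q \<otimes> (m \<otimes> m)" and ?d' = "r \<otimes> r \<otimes> (N \<otimes> N)"
  have mN2: "m \<otimes> m \<otimes> (N \<otimes> N) = \<one>" and Nm2: "N \<otimes> N \<otimes> (m \<otimes> m) = \<one>"
    using m N by (metis mN Nm m_assoc m_closed r_one)+
  have rr: "a \<otimes> (r \<otimes> r \<otimes> b) = r \<otimes> r \<otimes> (a \<otimes> b)" if "a \<in> carrier R" "b \<in> carrier R" for a b
    using that closed r_left[of a "r \<otimes> b"] r_left[of a b] by (simp add: m_assoc)
  have QQrr: "r \<otimes> r \<otimes> (Q \<otimes> Q \<otimes> a) = a" "Q \<otimes> Q \<otimes> (r \<otimes> r \<otimes> a) = a" if "a \<in> carrier R" for a
    using that closed by (simp_all add: m_assoc Q_r_cancel)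
  have "?d \<otimes> ?d' = \<one>"
    using closed m N QQrr(1)[of \<one>] by (simp add: rr) (simp add: m_assoc[of "Q \<otimes> Q"] mN2)
  moreover have "?d' \<otimes> ?d = \<one>"
  proof -
    have "?d' \<otimes> ?d = r \<otimes> r \<otimes> ((N \<otimes> N) \<otimes> (Q \<otimes> Q \<otimes> (m \<otimes> m)))"
      using closed m N by (simp add: m_assoc)
    also have "(N \<otimes> N) \<otimes> (Q \<otimes> Q \<otimes> (m \<otimes> m)) = Q \<otimes> Q \<otimes> (N \<otimes> N \<otimes> (m \<otimes> m))"
    proof -
      have "a \<otimes> (Q \<otimes> Q) = Q \<otimes> Q \<otimes> a" if "a \<in> carrier R" for a
        using that closed central(1)[of a] by (metis m_assoc)
      from this[of "N \<otimes> N"] show ?thesis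
        using closed m N m_assoc[of "N \<otimes> N" "Q \<otimes> Q" "m \<otimes> m"] m_assoc[of "Q \<otimes> Q" "N \<otimes> N" "m \<otimes> m"]
        by simp
    qed
    finally show ?thesis
      using closed QQrr(1)[of \<one>] by (simp add: Nm2)
  qed
  ultimately have inv_d: "inv ?d = ?d'"
    using closed m N by (intro inv_unique'[symmetric]) simp_all
  have "\<ominus> ((\<one> \<ominus> s \<otimes> s \<otimes> p) \<otimes> (\<one> \<ominus> s' \<otimes> s' \<otimes> p)) = Q \<otimes> Q \<otimes> p \<ominus> m \<otimes> m"
  proof -
    have sp: "s \<otimes> s \<otimes> p \<otimes> (s' \<otimes> s' \<otimes> p) = p \<otimes> p"
    proof -
      have "s \<otimes> s \<otimes> p \<otimes> (s' \<otimes> s' \<otimes> p) = s \<otimes> s \<otimes> (p \<otimes> s' \<otimes> (s' \<otimes> p))"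
        using s p(2) by (simp add: m_assoc)
      also have "p \<otimes> s' \<otimes> (s' \<otimes> p) = s' \<otimes> (s' \<otimes> (p \<otimes> p))"
        using s p(2) s'_central[of p] by (metis m_assoc m_closed)
      also have "s \<otimes> s \<otimes> (s' \<otimes> (s' \<otimes> (p \<otimes> p))) = p \<otimes> p"
        using s p(2) inverse(1) by (metis m_assoc m_closed l_one)
      finally show ?thesis .
    qed
    have QQ: "Q \<otimes> Q \<otimes> p = s \<otimes> s \<otimes> p \<ominus> p \<ominus> p \<oplus> s' \<otimes> s' \<otimes> p"
    proof -
      have "Q \<otimes> Q = s \<otimes> s \<ominus> s' \<otimes> s \<ominus> s \<otimes> s' \<oplus> s' \<otimes> s'"
        using s unfolding Q by (simp add: expand)
      then show ?thesis
        using s p(2) unfolding inverse by (simp add: expand)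
    qed
    have mm: "m \<otimes> m = \<one> \<ominus> p \<ominus> p \<oplus> p \<otimes> p"
      using p(2) unfolding m_def by (simp add: expand)
    have "(\<one> \<ominus> a) \<otimes> (\<one> \<ominus> b) = \<one> \<ominus> a \<ominus> b \<oplus> a \<otimes> b"
      if "a \<in> carrier R" "b \<in> carrier R" for a b
      using that by (simp add: expand) algebra
    then have prod: "(\<one> \<ominus> s \<otimes> s \<otimes> p) \<otimes> (\<one> \<ominus> s' \<otimes> s' \<otimes> p)
        = \<one> \<ominus> s \<otimes> s \<otimes> p \<ominus> s' \<otimes> s' \<otimes> p \<oplus> p \<otimes> p"
      using s p(2) by (simp add: sp)
    have "\<ominus> (\<one> \<ominus> a \<ominus> b \<oplus> c) = a \<ominus> t \<oplus> b \<ominus> (\<one> \<ominus> t \<oplus> c)"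
      if "a \<in> carrier R" "b \<in> carrier R" "c \<in> carrier R" "t \<in> carrier R" for a b c t
    proof -
      have "a \<ominus> t \<oplus> b \<ominus> (\<one> \<ominus> t \<oplus> c) = (a \<oplus> b) \<ominus> (\<one> \<oplus> c) \<oplus> (t \<ominus> t)"
        using that by algebra
      also have "t \<ominus> t = \<zero>"
        using that by algebra
      finally show ?thesis
        using that by algebra
    qed
    \<comment> \<open>The letter t stands for p + p, the middle term shared by Q^2 p and (1 -
      p)^2.\<close>
    from this[of "s \<otimes> s \<otimes> p" "s' \<otimes> s' \<otimes> p" "p \<otimes> p" "p \<oplus> p"]
    show ?thesis
      using s p(2) unfolding prod QQ mm by (simp add: a_minus_def minus_add a_assoc)
  qed
  then have "\<ominus> ((\<one> \<ominus> s \<otimes> s \<otimes> p) \<otimes> (\<one> \<ominus> s' \<otimes> s' \<otimes> p)) \<otimes> ?d'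
      = Q \<otimes> Q \<otimes> p \<otimes> ?d' \<ominus> m \<otimes> m \<otimes> ?d'"
    using closed m N p(2) by (simp add: a_minus_def l_distr l_minus)
  also have "Q \<otimes> Q \<otimes> p \<otimes> ?d' = F \<oplus> F \<otimes> F"
  proof -
    have "Q \<otimes> Q \<otimes> p \<otimes> ?d' = Q \<otimes> Q \<otimes> (r \<otimes> r \<otimes> (p \<otimes> (N \<otimes> N)))"
      using closed m N p(2) by (simp add: rr m_assoc[of "Q \<otimes> Q" p])
    also have "\<dots> = p \<otimes> N \<otimes> N"
      using N p(2) by (simp add: QQrr m_assoc)
    finally show ?thesis
      using closed unfolding pN by (simp add: N_def r_distr)
  qed
  also have "m \<otimes> m \<otimes> ?d' = r \<otimes> r"
    using closed m N by (simp add: rr mN2)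
  finally show ?thesis
    unfolding p(1)[symmetric] m_def[symmetric] inv_d first_identity by simp
qed

end

section \<open>The affine BMW algebra\<close>

text \<open>Setting for the commutation of the Y_i, which concerns multiplication only. The element
  \<open>y 1\<close> stands for z X and obeys the relations of X because z is central.\<close>

locale braid_monoid = monoid +
  fixes t y :: "nat \<Rightarrow> 'a" and k :: nat
  assumes t_closed: "1 \<le> j \<Longrightarrow> j < k \<Longrightarrow> t j \<in> carrier G"
    and y_one_closed: "y 1 \<in> carrier G"
    and y_Suc: "1 \<le> j \<Longrightarrow> j < k \<Longrightarrow> y (Suc j) = t j \<otimes> y j \<otimes> t j"
    and far: "1 \<le> j \<Longrightarrow> Suc j < l \<Longrightarrow> l < k \<Longrightarrow> t j \<otimes> t l = t l \<otimes> t j"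
    and braid: "1 \<le> j \<Longrightarrow> Suc j < k \<Longrightarrow>
      t j \<otimes> t (Suc j) \<otimes> t j = t (Suc j) \<otimes> t j \<otimes> t (Suc j)"
    and y_one_t_one: "1 < k \<Longrightarrow> y 1 \<otimes> t 1 \<otimes> y 1 \<otimes> t 1 = t 1 \<otimes> y 1 \<otimes> t 1 \<otimes> y 1"
    and y_one_t: "1 < l \<Longrightarrow> l < k \<Longrightarrow> y 1 \<otimes> t l = t l \<otimes> y 1"
begin

lemma y_closed: "1 \<le> j \<Longrightarrow> j \<le> k \<Longrightarrow> y j \<in> carrier G"
proof (induction j rule: nat_induct_at_least)
  case base
  show ?case by (rule y_one_closed)
next
  case (Suc j)
  then show ?case by (simp add: y_Suc t_closed)
qed

text \<open>For l > j + 1 the element \<open>t l\<close> commutes with every factor of t_j y_j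
  t_j.\<close>

lemma y_t_far: "1 \<le> j \<Longrightarrow> j < l \<Longrightarrow> l < k \<Longrightarrow> y j \<otimes> t l = t l \<otimes> y j"
proof (induction j rule: nat_induct_at_least)
  case base
  then show ?case using y_one_t[of l] by simp
next
  case (Suc j)
  have closed: "t j \<in> carrier G" "t l \<in> carrier G" "y j \<in> carrier G"
    using Suc by (simp_all add: t_closed y_closed)
  have tt: "t j \<otimes> t l = t l \<otimes> t j" and yt: "y j \<otimes> t l = t l \<otimes> y j"
    using Suc far[of j l] by simp_all
  have "y (Suc j) \<otimes> t l = t j \<otimes> (y j \<otimes> (t j \<otimes> t l))"
    using Suc closed by (simp add: y_Suc m_assoc)
  also have "\<dots> = t j \<otimes> ((y j \<otimes> t l) \<otimes> t j)"
    using closed unfolding tt by (simp add: m_assoc)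
  also have "\<dots> = (t j \<otimes> t l) \<otimes> y j \<otimes> t j"
    using closed unfolding yt by (simp add: m_assoc)
  also have "\<dots> = t l \<otimes> y (Suc j)"
    using Suc closed unfolding tt by (simp add: y_Suc m_assoc)
  finally show ?case .
qed

text \<open>The four-term relation between X and T_1 propagates: with a = t_j, b = t_(j+1), w = y_j,
  the element a w a satisfies it with b if w does with a.\<close>

lemma y_t: "1 \<le> j \<Longrightarrow> j < k \<Longrightarrow> y j \<otimes> t j \<otimes> y j \<otimes> t j = t j \<otimes> y j \<otimes> t j \<otimes> y j"
proof (induction j rule: nat_induct_at_least)
  case base
  then show ?case using y_one_t_one by simp
next
  case (Suc j)
  obtain a b w where abw: "a = t j" "b = t (Suc j)" "w = y j" by simp
  have closed: "a \<in> carrier G" "b \<in> carrier G" "w \<in> carrier G"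
    using Suc by (simp_all add: abw t_closed y_closed)
  have aba: "a \<otimes> b \<otimes> a = b \<otimes> a \<otimes> b" and wb: "w \<otimes> b = b \<otimes> w"
    and wawa: "w \<otimes> a \<otimes> w \<otimes> a = a \<otimes> w \<otimes> a \<otimes> w"
    using Suc by (simp_all add: abw braid y_t_far)
  let ?v = "a \<otimes> w \<otimes> a"
  \<comment> \<open>The relations a b a = b a b and w b = b w bring the word to a b (a w a w) b a.
    There the induction hypothesis reverses the middle, and the same moves are undone on the other
    side.\<close>
  have "b \<otimes> ?v \<otimes> b \<otimes> ?v = b \<otimes> a \<otimes> w \<otimes> (a \<otimes> b \<otimes> a) \<otimes> w \<otimes> a"
    using closed by (simp add: m_assoc)
  also have "\<dots> = b \<otimes> a \<otimes> (w \<otimes> b) \<otimes> a \<otimes> (b \<otimes> w) \<otimes> a"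
    using closed unfolding aba by (simp add: m_assoc)
  also have "\<dots> = b \<otimes> a \<otimes> b \<otimes> (w \<otimes> a \<otimes> w) \<otimes> b \<otimes> a"
    using closed unfolding wb[symmetric] by (subst wb) (simp add: m_assoc)
  also have "\<dots> = a \<otimes> b \<otimes> (a \<otimes> w \<otimes> a \<otimes> w) \<otimes> b \<otimes> a"
    using closed unfolding aba[symmetric] by (simp add: m_assoc)
  also have "\<dots> = a \<otimes> (b \<otimes> w) \<otimes> a \<otimes> w \<otimes> (a \<otimes> b \<otimes> a)"
    using closed unfolding wawa[symmetric] by (simp add: m_assoc)
  also have "\<dots> = a \<otimes> w \<otimes> b \<otimes> a \<otimes> (w \<otimes> b) \<otimes> a \<otimes> b"
    using closed unfolding aba wb[symmetric] by (simp add: m_assoc)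
  also have "\<dots> = a \<otimes> w \<otimes> (b \<otimes> a \<otimes> b) \<otimes> w \<otimes> a \<otimes> b"
    using closed unfolding wb by (simp add: m_assoc)
  also have "\<dots> = ?v \<otimes> b \<otimes> ?v \<otimes> b"
    using closed unfolding aba[symmetric] by (simp add: m_assoc)
  finally show ?case
    using Suc by (simp add: abw y_Suc)
qed

text \<open>Substituting y_(j+1) = t_j y_j t_j, the two products are exactly the two sides of
  \<open>y_t\<close>.\<close>

lemma y_commute:
  assumes "1 \<le> j" and "j < k"
  shows "y j \<otimes> y (Suc j) = y (Suc j) \<otimes> y j"
  using assms y_t[OF assms] t_closed[of j] y_closed[of j] by (simp add: y_Suc m_assoc)

end

section \<open>The group algebra of the affine braid group and its quotient\<close>

locale affine_BMW_data = C: cring C for C :: "('c, 'm) ring_scheme" +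
  fixes q z :: 'c and Z0 :: "int \<Rightarrow> 'c" and k :: nat
  assumes q_unit: "q \<in> Units C" and z_unit: "z \<in> Units C"
    and q_diff_unit: "q \<ominus>\<^bsub>C\<^esub> inv\<^bsub>C\<^esub> q \<in> Units C"
    and Z0_closed: "Z0 l \<in> carrier C"
begin

abbreviation "G \<equiv> affine_braid_group k"
abbreviation "B \<equiv> CB C k"
abbreviation "sc \<equiv> CB_scalar C k"
abbreviation "W \<equiv> affine_BMW C q z Z0 k"
abbreviation "\<pi> \<equiv> BMW_proj C q z Z0 k"

definition gen :: "braid_gen \<Rightarrow> 'c braid_alg" where
  "gen a = ga_single C G \<one>\<^bsub>C\<^esub> (braid_elem k a)"

sublocale group_ring C G
  by (intro group_ring.intro C.ring_axioms) (simp add: affine_braid_group_def group_presented_group)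

sublocale B: ring B
  unfolding CB_def by (rule ring_group_algebra)

lemma braid_elem_closed: "a \<in> braid_gens k \<Longrightarrow> braid_elem k a \<in> carrier G"
  by (auto simp: affine_braid_group_def braid_elem_def carrier_presented_group)

lemma gen_unit:
  assumes "a \<in> braid_gens k"
  shows "gen a \<in> Units B"
proof -
  have "gen a \<otimes>\<^bsub>B\<^esub> ga_single C G \<one>\<^bsub>C\<^esub> (inv\<^bsub>G\<^esub> (braid_elem k a)) = \<one>\<^bsub>B\<^esub>"
    "ga_single C G \<one>\<^bsub>C\<^esub> (inv\<^bsub>G\<^esub> (braid_elem k a)) \<otimes>\<^bsub>B\<^esub> gen a = \<one>\<^bsub>B\<^esub>"
    using braid_elem_closed[OF assms] by (simp_all add: CB_def gen_def single_mult_single one_eq_single)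
  then show ?thesis
    by (auto simp: Units_def CB_def gen_def single_closed)
qed

lemma gen_closed: "a \<in> braid_gens k \<Longrightarrow> gen a \<in> carrier B"
  using gen_unit by blast

text \<open>Singletons multiply as in the group, so the class of a positive word is the product of
  its letters. All relators in \<open>braid_rels\<close> are positive, and each thereby becomes an
  equation in the group algebra.\<close>

lemma gen_word:
  assumes "set as \<subseteq> braid_gens k"
  shows "foldr (\<lambda>a b. gen a \<otimes>\<^bsub>B\<^esub> b) as \<one>\<^bsub>B\<^esub>
    = ga_single C G \<one>\<^bsub>C\<^esub> (pres_class (braid_gens k) (braid_rels k) (pos_word as))"
  using assms
proof (induction as)
  case Nil
  have "\<one>\<^bsub>G\<^esub> = pres_class (braid_gens k) (braid_rels k) []"
    by (simp add: affine_braid_group_def presented_group_def)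
  then show ?case
    by (simp add: CB_def one_eq_single)
next
  case (Cons a as)
  then have "pos_word as \<in> lists (braid_gens k \<times> UNIV)" and "a \<in> braid_gens k"
    by auto
  then have "pres_class (braid_gens k) (braid_rels k) (pos_word as) \<in> carrier G"
      "braid_elem k a \<otimes>\<^bsub>G\<^esub> pres_class (braid_gens k) (braid_rels k) (pos_word as)
        = pres_class (braid_gens k) (braid_rels k) (pos_word (a # as))"
    by (simp_all add: affine_braid_group_def braid_elem_def carrier_presented_group pres_class_mult)
  then show ?case
    using Cons \<open>a \<in> braid_gens k\<close>
    by (simp add: gen_def CB_def single_mult_single braid_elem_closed)
qed

lemma gen_relation:
  assumes "(pos_word as, pos_word bs) \<in> braid_rels k" and "set as \<subseteq> braid_gens k" and "set bs \<subseteq> braid_gens k"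
  shows "foldr (\<lambda>a b. gen a \<otimes>\<^bsub>B\<^esub> b) as \<one>\<^bsub>B\<^esub> = foldr (\<lambda>a b. gen a \<otimes>\<^bsub>B\<^esub> b) bs \<one>\<^bsub>B\<^esub>"
proof -
  have "pos_word as \<in> lists (braid_gens k \<times> UNIV)" "pos_word bs \<in> lists (braid_gens k \<times> UNIV)"
    using assms(2,3) by auto
  from presented_group_relator[OF assms(1) this] show ?thesis
    by (simp add: gen_word assms(2,3))
qed

lemma scalar_hom: "sc \<in> ring_hom C B"
proof (rule ring_hom_memI)
  fix a b assume a: "a \<in> carrier C" and b: "b \<in> carrier C"
  show "sc a \<in> carrier B"
    using a by (simp add: CB_def CB_scalar_def single_closed)
  show "sc (a \<otimes>\<^bsub>C\<^esub> b) = sc a \<otimes>\<^bsub>B\<^esub> sc b"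
    using a b by (simp add: CB_def CB_scalar_def single_mult_single)
  show "sc (a \<oplus>\<^bsub>C\<^esub> b) = sc a \<oplus>\<^bsub>B\<^esub> sc b"
    unfolding CB_def CB_scalar_def using a b
    by (intro eqI add_closed single_closed) (auto simp: add_eq ga_single_def)
qed (simp add: CB_def CB_scalar_def one_eq_single)

sublocale sc: ring_hom_ring C B sc
  using scalar_hom by (intro ring_hom_ringI2) unfold_locales

lemma scalar_central:
  assumes "c \<in> carrier C" and "f \<in> carrier B"
  shows "sc c \<otimes>\<^bsub>B\<^esub> f = f \<otimes>\<^bsub>B\<^esub> sc c"
  unfolding CB_def CB_scalar_def using assms
  by (intro eqI) (simp_all add: CB_def mult_closed single_closed single_mult_eq mult_single_one_eq
      coeff_closed C.m_comm)

lemma scalar_unit: "c \<in> Units C \<Longrightarrow> sc c \<in> Units B"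
proof -
  assume c: "c \<in> Units C"
  then have "sc c \<otimes>\<^bsub>B\<^esub> sc (inv\<^bsub>C\<^esub> c) = \<one>\<^bsub>B\<^esub>" "sc (inv\<^bsub>C\<^esub> c) \<otimes>\<^bsub>B\<^esub> sc c = \<one>\<^bsub>B\<^esub>"
    by (simp_all add: sc.hom_mult[symmetric] C.Units_closed)
  with c show ?thesis
    by (auto simp: Units_def[of B] C.Units_closed intro!: bexI[of _ "sc (inv\<^bsub>C\<^esub> c)"])
qed

lemma T_eq: "CB_T C k j = gen (TGen j)" and X_eq: "CB_X C k = gen XGen"
  by (simp_all add: CB_T_def CB_X_def gen_def)

lemma T_unit: "1 \<le> j \<Longrightarrow> j < k \<Longrightarrow> CB_T C k j \<in> Units B"
  by (simp add: T_eq gen_unit braid_gens_def)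

lemma T_closed: "1 \<le> j \<Longrightarrow> j < k \<Longrightarrow> CB_T C k j \<in> carrier B"
  using T_unit by blast

lemma X_unit: "CB_X C k \<in> Units B"
  by (simp add: X_eq gen_unit braid_gens_def)

lemma X_closed: "CB_X C k \<in> carrier B"
  using X_unit by blast

sublocale Y: braid_monoid B "CB_T C k" "CB_Y C z k" k
proof
  let ?T = "CB_T C k" and ?X = "CB_X C k" and ?z = "sc z"
  have zC: "z \<in> carrier C" and z: "?z \<in> carrier B"
    using z_unit by auto
  note closed = z X_closed
  fix j l :: nat
  show "?T j \<in> carrier B" if "1 \<le> j" "j < k"
    using that by (rule T_closed)
  show "CB_Y C z k 1 \<in> carrier B"
    using closed by simp
  show "CB_Y C z k (Suc j) = ?T j \<otimes>\<^bsub>B\<^esub> CB_Y C z k j \<otimes>\<^bsub>B\<^esub> ?T j" if "1 \<le> j"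
    using that by (cases j) simp_all
  show "?T j \<otimes>\<^bsub>B\<^esub> ?T l = ?T l \<otimes>\<^bsub>B\<^esub> ?T j" if "1 \<le> j" "Suc j < l" "l < k"
    using gen_relation[of "[TGen j, TGen l]" "[TGen l, TGen j]"] that
    by (simp add: T_eq braid_gens_def braid_rels_def gen_closed)
  show "?T j \<otimes>\<^bsub>B\<^esub> ?T (Suc j) \<otimes>\<^bsub>B\<^esub> ?T j = ?T (Suc j) \<otimes>\<^bsub>B\<^esub> ?T j \<otimes>\<^bsub>B\<^esub> ?T (Suc j)"
    if "1 \<le> j" "Suc j < k"
    using gen_relation[of "[TGen j, TGen (j + 1), TGen j]" "[TGen (j + 1), TGen j, TGen (j + 1)]"] that
    by (simp add: T_eq braid_gens_def braid_rels_def gen_closed B.m_assoc)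
  show "CB_Y C z k 1 \<otimes>\<^bsub>B\<^esub> ?T l = ?T l \<otimes>\<^bsub>B\<^esub> CB_Y C z k 1" if l: "1 < l" "l < k"
  proof -
    have "?X \<otimes>\<^bsub>B\<^esub> ?T l = ?T l \<otimes>\<^bsub>B\<^esub> ?X"
      using gen_relation[of "[XGen, TGen l]" "[TGen l, XGen]"] l
      by (simp add: T_eq X_eq braid_gens_def braid_rels_def gen_closed)
    moreover have "?T l \<in> carrier B"
      using l by (simp add: T_closed)
    moreover have "?z \<otimes>\<^bsub>B\<^esub> ?T l = ?T l \<otimes>\<^bsub>B\<^esub> ?z"
      using zC \<open>?T l \<in> carrier B\<close> by (rule scalar_central)
    ultimately show ?thesis
      using closed by (metis B.m_assoc CB_Y.simps(1) One_nat_def)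
  qed
  show "CB_Y C z k 1 \<otimes>\<^bsub>B\<^esub> ?T 1 \<otimes>\<^bsub>B\<^esub> CB_Y C z k 1 \<otimes>\<^bsub>B\<^esub> ?T 1
      = ?T 1 \<otimes>\<^bsub>B\<^esub> CB_Y C z k 1 \<otimes>\<^bsub>B\<^esub> ?T 1 \<otimes>\<^bsub>B\<^esub> CB_Y C z k 1" if k: "1 < k"
  proof -
    have T: "?T 1 \<in> carrier B"
      using k by (simp add: T_closed)
    have XT: "?X \<otimes>\<^bsub>B\<^esub> ?T 1 \<otimes>\<^bsub>B\<^esub> ?X \<otimes>\<^bsub>B\<^esub> ?T 1 = ?T 1 \<otimes>\<^bsub>B\<^esub> ?X \<otimes>\<^bsub>B\<^esub> ?T 1 \<otimes>\<^bsub>B\<^esub> ?X"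
      using gen_relation[of "[XGen, TGen 1, XGen, TGen 1]" "[TGen 1, XGen, TGen 1, XGen]"] k
      by (simp add: T_eq X_eq braid_gens_def braid_rels_def gen_closed B.m_assoc)
    \<comment> \<open>Collecting the central factors z in front reduces the relation for z X to the
      one for X.\<close>
    have left: "a \<otimes>\<^bsub>B\<^esub> (?z \<otimes>\<^bsub>B\<^esub> b) = ?z \<otimes>\<^bsub>B\<^esub> (a \<otimes>\<^bsub>B\<^esub> b)" if "a \<in> carrier B" "b \<in> carrier B" for a b
      using that z scalar_central[OF zC, of a] by (metis B.m_assoc)
    show ?thesis
      using closed T XT by (simp add: B.m_assoc left[of "?X"] left[of "?T (Suc 0)"])
  qed
qed

lemma E_closed: "1 \<le> j \<Longrightarrow> j < k \<Longrightarrow> CB_E C q k j \<in> carrier B"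
  unfolding CB_E_def using q_diff_unit T_unit[of j]
  by (intro B.minus_closed B.m_closed) (auto intro: B.Units_closed)

lemma Y_one_unit: "CB_Y C z k 1 \<in> Units B"
  using z_unit X_unit by (simp add: scalar_unit)

text \<open>A negative exponent means the inverse of a natural power, which stays in the carrier
  because the base is a unit. This serves the relations with Y_1^l.\<close>

lemma int_pow_closed:
  assumes "x \<in> Units B"
  shows "x [^]\<^bsub>B\<^esub> (l :: int) \<in> carrier B"
proof -
  have "x [^]\<^bsub>B\<^esub> (n :: nat) \<in> carrier B" "inv\<^bsub>B\<^esub> (x [^]\<^bsub>B\<^esub> n) \<in> carrier B" for n
    using B.Units_pow_closed[OF assms, of n] by (rule B.Units_closed, rule B.Units_inv_closed)
  then show ?thesis
    by (simp only: int_pow_def2 split: if_split) blast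
qed

text \<open>\<open>genideal_ideal\<close> requires the generating set to lie in the carrier.\<close>

lemma rels_closed: "(a, b) \<in> BMW_rels C q z Z0 k \<Longrightarrow> a \<in> carrier B \<and> b \<in> carrier B"
proof -
  have sc: "sc z \<in> carrier B" "sc (inv\<^bsub>C\<^esub> z) \<in> carrier B" "sc (Z0 l) \<in> carrier B" for l
    using z_unit Z0_closed by auto
  have T': "inv\<^bsub>B\<^esub> (CB_T C k j) \<in> carrier B" if "1 \<le> j" "j < k" for j
    using T_unit[OF that] by simp
  have Y1: "CB_Y C z k (Suc 0) [^]\<^bsub>B\<^esub> l \<in> carrier B" for l :: int
    using int_pow_closed[OF Y_one_unit] by simp
  show "(a, b) \<in> BMW_rels C q z Z0 k \<Longrightarrow> a \<in> carrier B \<and> b \<in> carrier B"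
    unfolding BMW_rels_def Let_def
    by (auto simp del: CB_Y.simps intro!: B.m_closed sc T_closed T' E_closed Y.y_closed Y1)
qed

sublocale I: ideal "BMW_ideal C q z Z0 k" B
  unfolding BMW_ideal_def
  by (rule B.genideal_ideal) (use rels_closed in \<open>auto intro!: B.minus_closed\<close>)

lemma ring_W: "ring W"
  unfolding affine_BMW_def by (rule I.quotient_is_ring)

sublocale \<pi>: ring_hom_ring B W \<pi>
proof -
  have "\<pi> = (+>\<^bsub>B\<^esub>) (BMW_ideal C q z Z0 k)"
    by (simp add: BMW_proj_def fun_eq_iff)
  then show "ring_hom_ring B W \<pi>"
    unfolding affine_BMW_def by (simp add: I.rcos_ring_hom_ring)
qed

lemma W_surj: "w \<in> carrier W \<Longrightarrow> \<exists>a\<in>carrier B. w = \<pi> a"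
  by (auto simp: affine_BMW_def FactRing_def A_RCOSETS_def' BMW_proj_def)

lemma rel_eq:
  assumes "(a, b) \<in> BMW_rels C q z Z0 k"
  shows "\<pi> a = \<pi> b"
proof -
  have "a \<ominus>\<^bsub>B\<^esub> b \<in> BMW_ideal C q z Z0 k"
    unfolding BMW_ideal_def using assms rels_closed
    by (intro subsetD[OF B.genideal_self]) (auto intro!: B.minus_closed)
  then show ?thesis
    using rels_closed[OF assms] B.quotient_eq_iff_same_a_r_cos[OF I.is_ideal]
    by (simp add: BMW_proj_def)
qed

lemma E_T'_rel:
  assumes "1 \<le> j" and "j < k"
  shows "\<pi> (CB_E C q k j \<otimes>\<^bsub>B\<^esub> inv\<^bsub>B\<^esub> (CB_T C k j)) = \<pi> (sc z \<otimes>\<^bsub>B\<^esub> CB_E C q k j)"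
  by (rule rel_eq, unfold BMW_rels_def Let_def, intro UnI1 UN_I[of j])
    (use assms in simp_all)

end

section \<open>Power series over the affine BMW algebra\<close>

context affine_BMW_data
begin

sublocale PS: power_series W
  by (intro power_series.intro ring_W)

abbreviation "S \<equiv> power_series_ring W"
abbreviation "v \<equiv> ps_uinv W"

sublocale S: ring S
  by (rule PS.ring_PS)

text \<open>A ring homomorphism from the group algebra to the series ring. Braid relations, inverses
  and scalar identities are checked in the group algebra and transported along it.\<close>

definition \<phi> :: "'c braid_alg \<Rightarrow> nat \<Rightarrow> 'c braid_alg set" where
  "\<phi> a = ps_const W (\<pi> a)"

sublocale \<phi>: ring_hom_ring B S \<phi>
proof (rule ring_hom_ringI2[OF B.ring_axioms S.ring_axioms])
  show "\<phi> \<in> ring_hom B S"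
    using ring_hom_trans[OF \<pi>.homh PS.const_hom] by (simp add: \<phi>_def[abs_def] comp_def)
qed

text \<open>Coefficientwise: each coefficient of \<open>f\<close> is the image of a group algebra
  element, and scalars are central there.\<close>

lemma \<phi>_scalar_central:
  assumes "c \<in> carrier C" and "f \<in> carrier S"
  shows "\<phi> (sc c) \<otimes>\<^bsub>S\<^esub> f = f \<otimes>\<^bsub>S\<^esub> \<phi> (sc c)"
proof
  fix n
  have c: "sc c \<in> carrier B"
    using assms(1) by simp
  obtain a where "a \<in> carrier B" "f n = \<pi> a"
    using W_surj[of "f n"] assms(2) by (auto simp: PS.carrier_PS)
  then have "\<pi> (sc c) \<otimes>\<^bsub>W\<^esub> f n = f n \<otimes>\<^bsub>W\<^esub> \<pi> (sc c)"
    using c scalar_central[OF assms(1)] by (simp add: \<pi>.hom_mult[symmetric] del: \<pi>.hom_mult)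
  then show "(\<phi> (sc c) \<otimes>\<^bsub>S\<^esub> f) n = (f \<otimes>\<^bsub>S\<^esub> \<phi> (sc c)) n"
    using c assms(2) by (simp add: \<phi>_def PS.coeff_const_mult PS.coeff_mult_const)
qed

text \<open>Centrality of u merges the two factors, so x y is the monomial Y_i Y_(i+1) u^(-2) from
  which \<open>ps_frac W 2\<close> is built.\<close>

lemma series_product:
  assumes "a \<in> carrier B" and "b \<in> carrier B"
  shows "\<phi> a \<otimes>\<^bsub>S\<^esub> v \<otimes>\<^bsub>S\<^esub> (\<phi> b \<otimes>\<^bsub>S\<^esub> v) = ps_const W (\<pi> a \<otimes>\<^bsub>W\<^esub> \<pi> b) \<otimes>\<^bsub>S\<^esub> v [^]\<^bsub>S\<^esub> (2::nat)"
proof -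
  have closed: "\<phi> a \<in> carrier S" "\<phi> b \<in> carrier S" "v \<in> carrier S"
    using assms by (simp_all add: PS.uinv_closed)
  have "\<phi> a \<otimes>\<^bsub>S\<^esub> v \<otimes>\<^bsub>S\<^esub> (\<phi> b \<otimes>\<^bsub>S\<^esub> v) = \<phi> a \<otimes>\<^bsub>S\<^esub> (v \<otimes>\<^bsub>S\<^esub> \<phi> b) \<otimes>\<^bsub>S\<^esub> v"
    using closed by (simp add: S.m_assoc)
  also have "\<dots> = \<phi> (a \<otimes>\<^bsub>B\<^esub> b) \<otimes>\<^bsub>S\<^esub> (v \<otimes>\<^bsub>S\<^esub> v)"
    using closed assms by (simp add: PS.uinv_central[of "\<phi> b"] S.m_assoc)
  finally show ?thesis
    using closed assms by (simp add: \<phi>_def numeral_2_eq_2)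
qed

text \<open>The abstract setting applies with x = Y_i / u and y = Y_(i+1) / u; the equations for the
  three series are \<open>frac_eq\<close> with exponents 1 and 2.\<close>

lemma skein_series_BMW:
  assumes i: "1 \<le> i" "i < k"
  defines "Y \<equiv> CB_Y C z k i" and "Y' \<equiv> CB_Y C z k (i + 1)"
  shows "skein_series S (\<phi> (CB_T C k i)) (\<phi> (inv\<^bsub>B\<^esub> (CB_T C k i))) (\<phi> (CB_E C q k i))
    (\<phi> Y \<otimes>\<^bsub>S\<^esub> v) (\<phi> Y' \<otimes>\<^bsub>S\<^esub> v) (ps_frac W 1 (\<pi> Y)) (ps_frac W 1 (\<pi> Y'))
    (ps_frac W 2 (\<pi> Y \<otimes>\<^bsub>W\<^esub> \<pi> Y'))
    (\<phi> (sc (q \<ominus>\<^bsub>C\<^esub> inv\<^bsub>C\<^esub> q))) (\<phi> (sc (inv\<^bsub>C\<^esub> (q \<ominus>\<^bsub>C\<^esub> inv\<^bsub>C\<^esub> q))))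
    (\<phi> (sc z))"
proof -
  let ?T = "CB_T C k i" and ?T' = "inv\<^bsub>B\<^esub> (CB_T C k i)" and ?E = "CB_E C q k i"
  let ?Q = "q \<ominus>\<^bsub>C\<^esub> inv\<^bsub>C\<^esub> q"
  have T: "?T \<in> carrier B" "?T' \<in> carrier B" and E: "?E \<in> carrier B"
    and Y: "Y \<in> carrier B" "Y' \<in> carrier B"
    using i T_unit[OF i] by (simp_all add: T_closed E_closed Y.y_closed Y_def Y'_def del: CB_Y.simps)
  have v: "v \<in> carrier S"
    by (rule PS.uinv_closed)
  have C: "?Q \<in> carrier C" "inv\<^bsub>C\<^esub> ?Q \<in> carrier C" "z \<in> carrier C"
    using q_diff_unit z_unit by auto
  have Y'_eq: "Y' = ?T \<otimes>\<^bsub>B\<^esub> Y \<otimes>\<^bsub>B\<^esub> ?T" and YY': "Y \<otimes>\<^bsub>B\<^esub> Y' = Y' \<otimes>\<^bsub>B\<^esub> Y"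
    using Y.y_Suc[OF i] Y.y_commute[OF i] by (simp_all add: Y_def Y'_def del: CB_Y.simps)
  have pi: "\<pi> Y \<in> carrier W" "\<pi> Y' \<in> carrier W"
    using Y by simp_all
  have frac: "ps_frac W 1 a = ps_const W a \<otimes>\<^bsub>S\<^esub> v \<oplus>\<^bsub>S\<^esub> ps_const W a \<otimes>\<^bsub>S\<^esub> v \<otimes>\<^bsub>S\<^esub> ps_frac W 1 a"
    "ps_frac W 1 a = ps_const W a \<otimes>\<^bsub>S\<^esub> v \<oplus>\<^bsub>S\<^esub> ps_frac W 1 a \<otimes>\<^bsub>S\<^esub> (ps_const W a \<otimes>\<^bsub>S\<^esub> v)"
    if "a \<in> carrier W" for a
    using PS.frac_eq[OF that, of 1] v by simp_all
  show ?thesis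
  proof (intro skein_series.intro skein_series_axioms.intro)
    show "ring S" by (rule S.ring_axioms)
    show "\<phi> Y' \<otimes>\<^bsub>S\<^esub> v = \<phi> ?T \<otimes>\<^bsub>S\<^esub> (\<phi> Y \<otimes>\<^bsub>S\<^esub> v) \<otimes>\<^bsub>S\<^esub> \<phi> ?T"
      using T Y v PS.uinv_central[of "\<phi> ?T"] by (simp add: Y'_eq S.m_assoc)
    show "\<phi> Y \<otimes>\<^bsub>S\<^esub> v \<otimes>\<^bsub>S\<^esub> (\<phi> Y' \<otimes>\<^bsub>S\<^esub> v) = \<phi> Y' \<otimes>\<^bsub>S\<^esub> v \<otimes>\<^bsub>S\<^esub> (\<phi> Y \<otimes>\<^bsub>S\<^esub> v)"
      using Y YY' by (simp add: series_product \<pi>.hom_mult[symmetric] del: \<pi>.hom_mult)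
    show "\<phi> ?E = \<one>\<^bsub>S\<^esub> \<ominus>\<^bsub>S\<^esub> \<phi> (sc (inv\<^bsub>C\<^esub> ?Q)) \<otimes>\<^bsub>S\<^esub> (\<phi> ?T \<ominus>\<^bsub>S\<^esub> \<phi> ?T')"
      using T C by (simp add: CB_E_def a_minus_def)
    \<comment> \<open>Unlike the preceding equations, which are images of equations in the group
      algebra, this one comes from the relations imposed on W.\<close>
    show "\<phi> ?E \<otimes>\<^bsub>S\<^esub> \<phi> ?T' = \<phi> (sc z) \<otimes>\<^bsub>S\<^esub> \<phi> ?E"
      using T E C E_T'_rel[OF i]
      by (simp add: \<phi>.hom_mult[symmetric] del: \<phi>.hom_mult \<pi>.hom_mult) (simp add: \<phi>_def)
    show "\<phi> ?T \<otimes>\<^bsub>S\<^esub> \<phi> ?T' = \<one>\<^bsub>S\<^esub>" "\<phi> ?T' \<otimes>\<^bsub>S\<^esub> \<phi> ?T = \<one>\<^bsub>S\<^esub>"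
      using T T_unit[OF i] by (simp_all add: \<phi>.hom_mult[symmetric] del: \<phi>.hom_mult)
    show "\<phi> (sc ?Q) \<otimes>\<^bsub>S\<^esub> \<phi> (sc (inv\<^bsub>C\<^esub> ?Q)) = \<one>\<^bsub>S\<^esub>"
      using C q_diff_unit
      by (simp add: \<phi>.hom_mult[symmetric] sc.hom_mult[symmetric] del: \<phi>.hom_mult sc.hom_mult)
    show "ps_frac W 2 (\<pi> Y \<otimes>\<^bsub>W\<^esub> \<pi> Y') = \<phi> Y \<otimes>\<^bsub>S\<^esub> v \<otimes>\<^bsub>S\<^esub> (\<phi> Y' \<otimes>\<^bsub>S\<^esub> v)
        \<oplus>\<^bsub>S\<^esub> \<phi> Y \<otimes>\<^bsub>S\<^esub> v \<otimes>\<^bsub>S\<^esub> (\<phi> Y' \<otimes>\<^bsub>S\<^esub> v) \<otimes>\<^bsub>S\<^esub> ps_frac W 2 (\<pi> Y \<otimes>\<^bsub>W\<^esub> \<pi> Y')"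
      "ps_frac W 2 (\<pi> Y \<otimes>\<^bsub>W\<^esub> \<pi> Y') = \<phi> Y \<otimes>\<^bsub>S\<^esub> v \<otimes>\<^bsub>S\<^esub> (\<phi> Y' \<otimes>\<^bsub>S\<^esub> v)
        \<oplus>\<^bsub>S\<^esub> ps_frac W 2 (\<pi> Y \<otimes>\<^bsub>W\<^esub> \<pi> Y') \<otimes>\<^bsub>S\<^esub> (\<phi> Y \<otimes>\<^bsub>S\<^esub> v \<otimes>\<^bsub>S\<^esub> (\<phi> Y' \<otimes>\<^bsub>S\<^esub> v))"
      unfolding series_product[OF Y] by (rule PS.frac_eq; use pi in simp)+
    show "ps_frac W 1 (\<pi> Y) = \<phi> Y \<otimes>\<^bsub>S\<^esub> v \<oplus>\<^bsub>S\<^esub> \<phi> Y \<otimes>\<^bsub>S\<^esub> v \<otimes>\<^bsub>S\<^esub> ps_frac W 1 (\<pi> Y)"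
      "ps_frac W 1 (\<pi> Y) = \<phi> Y \<otimes>\<^bsub>S\<^esub> v \<oplus>\<^bsub>S\<^esub> ps_frac W 1 (\<pi> Y) \<otimes>\<^bsub>S\<^esub> (\<phi> Y \<otimes>\<^bsub>S\<^esub> v)"
      "ps_frac W 1 (\<pi> Y') = \<phi> Y' \<otimes>\<^bsub>S\<^esub> v \<oplus>\<^bsub>S\<^esub> \<phi> Y' \<otimes>\<^bsub>S\<^esub> v \<otimes>\<^bsub>S\<^esub> ps_frac W 1 (\<pi> Y')"
      "ps_frac W 1 (\<pi> Y') = \<phi> Y' \<otimes>\<^bsub>S\<^esub> v \<oplus>\<^bsub>S\<^esub> ps_frac W 1 (\<pi> Y') \<otimes>\<^bsub>S\<^esub> (\<phi> Y' \<otimes>\<^bsub>S\<^esub> v)"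
      unfolding \<phi>_def by (rule frac pi)+
  qed (use T E Y v C pi in \<open>simp_all add: \<phi>_scalar_central PS.frac_closed\<close>)
qed

end

theorem proposition3p5:
  fixes C :: "('c, 'm) ring_scheme" and q z :: 'c and Z0 :: "int \<Rightarrow> 'c" and i :: nat
    and S (structure)
  assumes "cring C"
    and "q \<in> Units C" and "z \<in> Units C" and "q \<ominus>\<^bsub>C\<^esub> inv\<^bsub>C\<^esub> q \<in> Units C"
    and "\<And>l. Z0 l \<in> carrier C"
    and "1 \<le> i"
    and "W = affine_BMW C q z Z0 (i + 1)"
    and "\<pi> = BMW_proj C q z Z0 (i + 1)"
    and "S = power_series_ring W"
    and "scalar = (\<lambda>c. ps_const W (\<pi> (CB_scalar C (i + 1) c)))"
    and "y = \<pi> (CB_Y C z (i + 1) i)"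
    and "y' = \<pi> (CB_Y C z (i + 1) (i + 1))"
    and "T = ps_const W (\<pi> (CB_T C (i + 1) i))"
    and "E = ps_const W (\<pi> (CB_E C q (i + 1) i))"
    and "U = ps_frac W 1 y" \<comment> \<open>\<open>Y\<^sub>i / (u - Y\<^sub>i)\<close>\<close>
    and "U' = ps_frac W 1 y'" \<comment> \<open>\<open>Y\<^sub>i\<^sub>+\<^sub>1 / (u - Y\<^sub>i\<^sub>+\<^sub>1)\<close>\<close>
    and "F = ps_frac W 2 (y \<otimes>\<^bsub>W\<^esub> y')" \<comment> \<open>\<open>Y\<^sub>i Y\<^sub>i\<^sub>+\<^sub>1 / (u\<^sup>2 - Y\<^sub>i Y\<^sub>i\<^sub>+\<^sub>1)\<close>\<close>
    and "P = ps_const W (y \<otimes>\<^bsub>W\<^esub> y')"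
    and "v = ps_uinv W"
    and "Q = scalar (q \<ominus>\<^bsub>C\<^esub> inv\<^bsub>C\<^esub> q)"
  shows
    \<comment> \<open>on the right, numerator and denominator of the fraction are divided by \<open>u\<^sup>4\<close>\<close>
    "(E \<otimes> U' \<ominus> T \<otimes> inv Q \<ominus> F) \<otimes> (E \<otimes> U \<oplus> inv T \<otimes> inv Q \<ominus> F)
      = \<ominus> ((\<one> \<ominus> scalar q [^] (2::nat) \<otimes> P \<otimes> v [^] (2::nat))
            \<otimes> (\<one> \<ominus> (inv (scalar q)) [^] (2::nat) \<otimes> P \<otimes> v [^] (2::nat)))
          \<otimes> inv (Q [^] (2::nat) \<otimes> (\<one> \<ominus> P \<otimes> v [^] (2::nat)) [^] (2::nat))
     \<and>
     (U' \<oplus> T \<otimes> inv Q \<ominus> E \<otimes> F)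
        \<ominus> Q [^] (2::nat) \<otimes> (U \<oplus> \<one>) \<otimes> (U' \<oplus> T \<otimes> inv Q \<ominus> E \<otimes> F) \<otimes> U
      = (T \<otimes> U \<otimes> inv T \<oplus> T \<otimes> inv Q \<ominus> E \<otimes> F)
        \<ominus> Q [^] (2::nat) \<otimes> U' \<otimes> (E \<otimes> U \<otimes> E \<oplus> scalar z \<otimes> E \<otimes> inv Q \<ominus> E \<otimes> F) \<otimes> (U' \<oplus> \<one>)"
proof -
  define k where "k = i + 1"
  interpret A: affine_BMW_data C q z Z0 k
    using assms(1-5) by (intro affine_BMW_data.intro affine_BMW_data_axioms.intro)
  note defs = assms(7-)[folded k_def]
  have i: "1 \<le> i" "i < k" and k: "1 \<le> k"
    using assms(6) by (simp_all add: k_def)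
  \<comment> \<open>The inverses are introduced as images of inverses in C and in the group algebra;
    uniqueness of inverses later identifies them with \<open>inv\<close> in
    \<open>S\<close>.\<close>
  define T' where "T' = A.\<phi> (inv\<^bsub>CB C k\<^esub> (CB_T C k i))"
  define x where "x = ps_const W y \<otimes> v"
  define x' where "x' = ps_const W y' \<otimes> v"
  define r where "r = scalar (inv\<^bsub>C\<^esub> (q \<ominus>\<^bsub>C\<^esub> inv\<^bsub>C\<^esub> q))"
  define s' where "s' = scalar (inv\<^bsub>C\<^esub> q)"
  \<comment> \<open>The y and \<open>V\<close> of the locale are \<open>x'\<close> and
    \<open>U'\<close> here; the \<open>y\<close> of the theorem is the image of Y_i itself, without
    the factor u^(-1).\<close>
  interpret skein_series S T T' E x x' U U' F Q r "scalar z"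
    using A.skein_series_BMW[OF i, folded k_def] unfolding defs T'_def x_def x'_def r_def A.\<phi>_def .
  have scalar: "scalar c = A.\<phi> (CB_scalar C k c)" for c
    unfolding defs A.\<phi>_def ..
  have S: "S = power_series_ring (affine_BMW C q z Z0 k)"
    unfolding defs ..
  have qC: "q \<in> carrier C" "inv\<^bsub>C\<^esub> q \<in> carrier C"
    using assms(2) by (auto intro: A.C.Units_closed)
  have s: "scalar q \<in> carrier S" "s' \<in> carrier S"
    unfolding s'_def scalar S using qC by simp_all
  have inverse: "scalar q \<otimes> s' = \<one>" "s' \<otimes> scalar q = \<one>"
    unfolding s'_def scalar S using qC assms(2)
    by (simp_all add: A.\<phi>.hom_mult[symmetric] A.sc.hom_mult[symmetric]
        del: A.\<phi>.hom_mult A.sc.hom_mult)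
  have s'_central: "s' \<otimes> a = a \<otimes> s'" if "a \<in> carrier S" for a
    using that qC unfolding s'_def scalar S by (intro A.\<phi>_scalar_central)
  have Q: "Q = scalar q \<ominus> s'"
  proof -
    have "Q = A.\<phi> (CB_scalar C k (q \<ominus>\<^bsub>C\<^esub> inv\<^bsub>C\<^esub> q))"
      unfolding defs A.\<phi>_def ..
    then show ?thesis
      unfolding s'_def scalar S using qC by (simp add: a_minus_def)
  qed
  have inv_T: "inv T = T'" and inv_Q: "inv Q = r" and inv_s: "inv (scalar q) = s'"
    using closed s inverse T_T' T'_T Q_r central(1)[of r] by (auto intro!: inv_unique'[symmetric])
  have xx': "P \<otimes> v [^] (2::nat) = x \<otimes> x'"
    using A.series_product[of "CB_Y C z k i" "CB_Y C z k k"] i k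
    unfolding x_def x'_def defs A.\<phi>_def by (simp add: A.Y.y_closed del: CB_Y.simps)
  have P: "P \<in> carrier S" and v: "v \<in> carrier S"
    unfolding defs using i k
    by (simp_all add: A.PS.const_closed A.PS.uinv_closed A.Y.y_closed del: CB_Y.simps)
  have square: "a [^] (2::nat) = a \<otimes> a" if "a \<in> carrier S" for a
    using that by (simp add: numeral_2_eq_2)
  have assoc: "a \<otimes> a \<otimes> P \<otimes> v [^] (2::nat) = a \<otimes> a \<otimes> (x \<otimes> x')" if "a \<in> carrier S" for a
    using that P v by (simp add: xx'[symmetric] m_assoc)
  have "\<one> \<ominus> x \<otimes> x' \<in> carrier S"
    using closed by simp
  then show ?thesis
    unfolding inv_T inv_Q inv_s xx' square[OF s(1)] square[OF s(2)] square[OF closed(9)]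
      square[OF \<open>\<one> \<ominus> x \<otimes> x' \<in> carrier S\<close>] assoc[OF s(1)] assoc[OF s(2)]
    using first_identity_fraction[OF s inverse s'_central Q] second_identity by blast
qed

end
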